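(* Let $n\ge 1$ be an integer and let $H(x)=\sum_{g\ge 0}A(n,g)\,x^{\lfloor\frac{n+1}{2}\rfloor-g}$. Then $H(x)$ has only non-positive real zeros (i.e. every complex zero of $H$ is real and $\le 0$), and the sequence $(A(n,g))_{g\ge0}$ is log-concave, i.e. $A(n,g)^2\ge A(n,g-1)\,A(n,g+1)$ for all $g\ge1$.
   Context: $A(n,g)$ is the number of rooted one-face maps of genus $g$ with $n$ edges, up to equivalence. A rooted one-face map with $n$ edges is encoded as a triple $(\alpha,\beta,\gamma)$ of permutations of $\{1,\dots,2n\}$ where $\alpha$ is an involution without fixed points (its cycles are the edges), $\gamma=(1,2,\dots,2n)$ is the long cycle (the boundary), and $\gamma=\alpha\beta$ (the cycles of $\beta$ are the vertices; products are composed right to left). The root has label $1$. Two triples $(\alpha,\beta,\gamma)$, $(\alpha',\beta',\gamma')$ are equivalent if there is a permutation $\pi$ with $\alpha'=\pi\alpha\pi^{-1}$, $\gamma'=\pi\gamma\pi^{-1}$, $\pi(1)=1$ (since $\gamma=\gamma'=(1,2,\dots,2n)$, this forces $\pi$ to be the identity). The genus $g$ is determined by $v-n+1=2-2g$, where $v$ is the number of cycles of $\beta$. Thus $A(n,g)$ is the number of fixed-point-free involutions $\alpha$ of $\{1,\dots,2n\}$ such that $\alpha^{-1}\gamma$ has exactly $n+1-2g$ cycles; in particular $A(n,g)=0$ if $2g>n$, so $H(x)$ is a polynomial. *)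

theory Defs
  imports
    Complex_Main
    "HOL-Computational_Algebra.Polynomial"
    "HOL-Combinatorics.Cycles"
    "HOL-Combinatorics.Orbits"
begin

text \<open>
  Permutations of \<open>{1..2n}\<close> are functions on \<^typ>\<open>nat\<close> that permute \<open>{1..2*n}\<close>, hence are the
  identity outside this set. Products are composed from right to left, i.e. they are \<open>\<circ>\<close>.
\<close>

type_synonym map_triple = "(nat \<Rightarrow> nat) \<times> (nat \<Rightarrow> nat) \<times> (nat \<Rightarrow> nat)"

definition long_cycle :: "nat \<Rightarrow> nat \<Rightarrow> nat" where
  "long_cycle n = cycle_of_list [1..<2 * n + 1]"

definition fpf_involution_on :: "(nat \<Rightarrow> nat) \<Rightarrow> nat set \<Rightarrow> bool" where
  "fpf_involution_on p S \<longleftrightarrow> p permutes S \<and> p \<circ> p = id \<and> (\<forall>i\<in>S. p i \<noteq> i)"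

text \<open>Fixed points of \<open>p\<close> in \<open>S\<close> are counted as cycles of length one.\<close>

definition num_cycles :: "(nat \<Rightarrow> nat) \<Rightarrow> nat set \<Rightarrow> nat" where
  "num_cycles p S = card (orbit p ` S)"

definition rooted_one_face_map :: "nat \<Rightarrow> map_triple \<Rightarrow> bool" where
  "rooted_one_face_map n = (\<lambda>(\<alpha>, \<beta>, \<gamma>).
     fpf_involution_on \<alpha> {1..2 * n} \<and> \<beta> permutes {1..2 * n} \<and>
     \<gamma> = long_cycle n \<and> \<gamma> = \<alpha> \<circ> \<beta>)"

text \<open>Euler's formula with \<open>n\<close> edges, one face, and the cycles of \<open>\<beta>\<close> as vertices.\<close>

definition has_genus :: "nat \<Rightarrow> map_triple \<Rightarrow> nat \<Rightarrow> bool" where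
  "has_genus n = (\<lambda>(\<alpha>, \<beta>, \<gamma>) g.
     int (num_cycles \<beta> {1..2 * n}) - int n + 1 = 2 - 2 * int g)"

definition rooted_one_face_maps :: "nat \<Rightarrow> nat \<Rightarrow> map_triple set" where
  "rooted_one_face_maps n g = {m. rooted_one_face_map n m \<and> has_genus n m g}"

definition rooted_map_equiv :: "nat \<Rightarrow> nat \<Rightarrow> (map_triple \<times> map_triple) set" where
  "rooted_map_equiv n g =
     {((\<alpha>, \<beta>, \<gamma>), (\<alpha>', \<beta>', \<gamma>')).
        (\<alpha>, \<beta>, \<gamma>) \<in> rooted_one_face_maps n g \<and>
        (\<alpha>', \<beta>', \<gamma>') \<in> rooted_one_face_maps n g \<and>
        (\<exists>\<pi>. \<pi> permutes {1..2 * n} \<and> \<pi> 1 = 1 \<and>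
             \<alpha>' = \<pi> \<circ> \<alpha> \<circ> inv \<pi> \<and> \<gamma>' = \<pi> \<circ> \<gamma> \<circ> inv \<pi>)}"

definition A :: "nat \<Rightarrow> nat \<Rightarrow> nat" where
  "A n g = card (rooted_one_face_maps n g // rooted_map_equiv n g)"

text \<open>
  The sum over all \<open>g \<ge> 0\<close> is finite because \<open>A n g = 0\<close> for \<open>2 * g > n\<close> (lemma \<open>A_eq_0\<close> below).
  For \<open>g \<le> n div 2\<close> the subtraction in the exponent does not truncate.
\<close>

definition H :: "nat \<Rightarrow> complex poly" where
  "H n = (\<Sum>g\<le>n div 2. monom (of_nat (A n g)) ((n + 1) div 2 - g))"

lemma long_cycle_eq:
  assumes "n \<ge> 1"
  shows "long_cycle n i = (if i \<in> {1..<2 * n} then i + 1 else if i = 2 * n then 1 else i)"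
proof -
  let ?L = "[1..<2 * n + 1]"
  have "map (long_cycle n) ?L = rotate1 ?L"
    using cyclic_rotation[of ?L 1] by (simp add: long_cycle_def)
  also have "rotate1 ?L = [2..<2 * n + 1] @ [1]"
    using assms by (simp add: upt_conv_Cons numeral_2_eq_2)
  finally have eq: "map (long_cycle n) ?L = [2..<2 * n + 1] @ [1]" .
  show ?thesis
  proof (cases "i \<in> {1..2 * n}")
    case True
    then have "long_cycle n i = map (long_cycle n) ?L ! (i - 1)"
      by (subst nth_map) (auto simp del: upt_Suc)
    also have "\<dots> = ([2..<2 * n + 1] @ [1]) ! (i - 1)"
      by (simp only: eq)
    finally show ?thesis
      using True by (auto simp: nth_append simp del: upt_Suc)
  next
    case False
    then show ?thesis
      using assms by (auto simp: long_cycle_def id_outside_supp simp del: upt_Suc)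
  qed
qed

lemma A_eq_0:
  assumes "n \<ge> 1" "2 * g > n"
  shows "A n g = 0"
proof -
  have "\<not> has_genus n (\<alpha>, \<beta>, \<gamma>) g" for \<alpha> \<beta> \<gamma>
  proof -
    have "num_cycles \<beta> {1..2 * n} > 0"
      using assms(1) by (simp add: num_cycles_def card_gt_0_iff)
    then show ?thesis
      using assms(2) unfolding has_genus_def prod.case by linarith
  qed
  then have "rooted_one_face_maps n g = {}"
    by (auto simp: rooted_one_face_maps_def)
  then show ?thesis
    by (simp add: A_def)
qed

lemma commuting_with_long_cycle:
  assumes "n \<ge> 1" "\<pi> permutes {1..2 * n}" "\<pi> 1 = 1"
    and "long_cycle n = \<pi> \<circ> long_cycle n \<circ> inv \<pi>"
  shows "\<pi> = id"
proof
  fix i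
  have comm: "long_cycle n (\<pi> j) = \<pi> (long_cycle n j)" for j
    using assms(2) by (subst assms(4)) (simp add: permutes_inverses)
  have *: "k < 2 * n \<Longrightarrow> \<pi> (Suc k) = Suc k" for k
  proof (induction k)
    case (Suc k)
    then show ?case
      using comm[of "Suc k"] by (simp add: long_cycle_eq[OF assms(1)])
  qed (use assms(3) in simp)
  show "\<pi> i = id i"
  proof (cases "i \<in> {1..2 * n}")
    case True
    then have "Suc (i - 1) = i" "i - 1 < 2 * n" by auto
    then show ?thesis using *[of "i - 1"] by simp
  next
    case False
    then show ?thesis using assms(2) by (simp add: permutes_not_in)
  qed
qed

lemma rooted_map_equiv_eq_Id_on:
  assumes "n \<ge> 1"
  shows "rooted_map_equiv n g = Id_on (rooted_one_face_maps n g)"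
proof (intro equalityI subrelI)
  fix m m' assume mm: "(m, m') \<in> rooted_map_equiv n g"
  obtain a b c a' b' c' where m: "m = (a, b, c)" "m' = (a', b', c')"
    by (cases m, cases m')
  from mm m obtain p where p: "p permutes {1..2 * n}" "p 1 = 1"
      "a' = p \<circ> a \<circ> inv p" "c' = p \<circ> c \<circ> inv p"
    and in1: "m \<in> rooted_one_face_maps n g" and in2: "m' \<in> rooted_one_face_maps n g"
    by (auto simp: rooted_map_equiv_def)
  have c: "c = long_cycle n" "c' = long_cycle n" "c = a \<circ> b" "c' = a' \<circ> b'" "a \<circ> a = id"
    using in1 in2 m
    by (auto simp: rooted_one_face_maps_def rooted_one_face_map_def fpf_involution_on_def)
  then have "p = id"
    using commuting_with_long_cycle[OF assms p(1,2)] p(4) by simp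
  then have a: "a' = a" using p(3) by simp
  have "b = a \<circ> c" "b' = a \<circ> c"
    using c a by (metis comp_assoc id_comp)+
  then show "(m, m') \<in> Id_on (rooted_one_face_maps n g)"
    using in1 m a c by auto
next
  fix m m' assume "(m, m') \<in> Id_on (rooted_one_face_maps n g)"
  then show "(m, m') \<in> rooted_map_equiv n g"
    by (cases m) (auto simp: rooted_map_equiv_def intro!: exI[of _ id] permutes_id)
qed

lemma A_eq_card_involutions:
  assumes "n \<ge> 1"
  shows "A n g = card {\<alpha>. fpf_involution_on \<alpha> {1..2 * n} \<and>
           num_cycles (inv \<alpha> \<circ> long_cycle n) {1..2 * n} + 2 * g = n + 1}"
    (is "_ = card ?S")
proof -
  let ?R = "rooted_one_face_maps n g"
  have "?R // rooted_map_equiv n g = (\<lambda>m. {m}) ` ?R"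
    by (auto simp: rooted_map_equiv_eq_Id_on[OF assms] quotient_def Image_def)
  then have 1: "A n g = card ?R"
    by (simp add: A_def card_image)
  have lc: "long_cycle n permutes {1..2 * n}"
    using cycle_permutes[of "[1..<2 * n + 1]"]
    by (simp add: long_cycle_def atLeastLessThanSuc_atLeastAtMost del: upt_Suc)
  have "?R = (\<lambda>a. (a, inv a \<circ> long_cycle n, long_cycle n)) ` ?S" (is "_ = ?f ` _")
  proof (intro equalityI subsetI)
    fix m assume m: "m \<in> ?R"
    obtain a b c where mm: "m = (a, b, c)" by (cases m)
    have inva: "inv a \<circ> (a \<circ> b) = b"
      using m mm by (auto simp: rooted_one_face_maps_def rooted_one_face_map_def
          fpf_involution_on_def fun_eq_iff permutes_inverses)
    then have "m = ?f a" "a \<in> ?S"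
      using m mm by (auto simp: rooted_one_face_maps_def rooted_one_face_map_def has_genus_def)
    then show "m \<in> ?f ` ?S" by blast
  next
    fix m assume "m \<in> ?f ` ?S"
    then obtain a where a: "a \<in> ?S" "m = ?f a" by blast
    then have "a permutes {1..2 * n}" by (simp add: fpf_involution_on_def)
    then have "inv a \<circ> long_cycle n permutes {1..2 * n}" "a \<circ> (inv a \<circ> long_cycle n) = long_cycle n"
      using lc by (auto intro: permutes_compose permutes_inv simp: fun_eq_iff permutes_inverses)
    then show "m \<in> ?R"
      using a by (auto simp: rooted_one_face_maps_def rooted_one_face_map_def has_genus_def)
  qed
  moreover have "inj_on ?f ?S" by (auto intro: inj_onI)
  ultimately show ?thesis using 1 by (simp add: card_image)
qed

end

theory Submission
  imports Defs
    "HOL-Combinatorics.Multiset_Permutations"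
    "HOL-Computational_Algebra.Formal_Power_Series"
    "HOL-Computational_Algebra.Fundamental_Theorem_Algebra"
begin

text \<open>
  The Harer-Zagier formula is obtained from a more general count of Zagier and Stanley: for a
  permutation \<open>\<alpha>\<close> of an \<open>m\<close>-element set with cycle lengths \<open>l\<^sub>1, l\<^sub>2, \<dots>\<close>, the number of pairs of a
  long cycle \<open>\<gamma>\<close> and an \<open>N\<close>-colouring \<open>f\<close> with \<open>f \<circ> \<gamma> = f \<circ> \<alpha>\<close> is \<open>(m - 1)!\<close> times the
  coefficient of \<open>x\<^sup>N\<close> in \<open>x \<cdot> (\<Prod>\<^sub>i (1 - x ^ l\<^sub>i)) / (1 - x) ^ (m + 2)\<close>. No characters are needed:
  deleting the successor \<open>j\<close> of a fixed element \<open>i\<close> from \<open>\<gamma>\<close> either splits the cycle of \<open>i\<close> in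
  \<open>\<alpha>\<close> or joins it with another one, and the right-hand side satisfies the same recursion.

  For \<open>\<alpha>\<close> a fixed-point-free involution this shows that \<open>P\<^sub>n(x) = \<Sum>\<^sub>\<alpha> x ^ cycles (\<alpha>\<gamma>)\<close> is a
  multiple of a polynomial \<open>p\<^sub>n\<close> with
  \<open>(n + 1) p\<^sub>n = 2 x p\<^sub>n\<^sub>-\<^sub>1 + (n - 1) p\<^sub>n\<^sub>-\<^sub>2\<close>. If \<open>Re w > 0\<close>, then inductively
  \<open>Re (p\<^sub>n(w) / p\<^sub>n\<^sub>-\<^sub>1(w)) > 0\<close>, so by parity all zeros of \<open>p\<^sub>n\<close> are purely imaginary. As
  \<open>P\<^sub>n(w) = w ^ e \<cdot> H(w\<^sup>2)\<close> with \<open>e \<in> {0, 1}\<close>, the zeros of \<open>H\<close> are real and non-positive, and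
  multiplying out the linear factors gives log-concavity.
\<close>

subsection \<open>Colourings compatible with a long cycle\<close>

text \<open>
  A long cycle is encoded as the cyclic list \<open>i # ys\<close>. In \<open>walk f \<alpha> c i ys\<close> the colour \<open>c\<close> is the one
  demanded of the next element; with \<open>c = f (\<alpha> i)\<close> the predicate says that the successor of each
  entry \<open>y\<close> has colour \<open>f (\<alpha> y)\<close>.
\<close>

fun walk :: "('a \<Rightarrow> 'b) \<Rightarrow> ('a \<Rightarrow> 'a) \<Rightarrow> 'b \<Rightarrow> 'a \<Rightarrow> 'a list \<Rightarrow> bool" where
  "walk f \<alpha> c e [] \<longleftrightarrow> f e = c"
| "walk f \<alpha> c e (y # ys) \<longleftrightarrow> f y = c \<and> walk f \<alpha> (f (\<alpha> y)) e ys"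

lemma walk_cong:
  assumes "\<And>y. y \<in> set ys \<Longrightarrow> f y = f' y \<and> f (\<alpha> y) = f' (\<alpha>' y)" "f e = f' e"
  shows "walk f \<alpha> c e ys = walk f' \<alpha>' c e ys"
  using assms by (induction ys arbitrary: c) auto

definition colourings :: "nat \<Rightarrow> ('a \<Rightarrow> 'a) \<Rightarrow> 'a \<Rightarrow> 'a list \<Rightarrow> ('a \<Rightarrow> nat) set" where
  "colourings N \<alpha> i ys = {f \<in> insert i (set ys) \<rightarrow>\<^sub>E {..<N}. walk f \<alpha> (f (\<alpha> i)) i ys}"

text \<open>
  The permutation that replaces \<open>\<alpha>\<close> when the successor \<open>j\<close> of \<open>i\<close> is deleted: \<open>i\<close> inherits the image
  of \<open>j\<close>, and the preimage of \<open>j\<close> is sent to \<open>\<alpha> i\<close>, which has the same colour as \<open>j\<close>.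
\<close>

definition contract :: "('a \<Rightarrow> 'a) \<Rightarrow> 'a \<Rightarrow> 'a \<Rightarrow> 'a \<Rightarrow> 'a" where
  "contract \<alpha> i j x = (let y = \<alpha> (if x = i then j else x) in if y = j then \<alpha> i else y)"

text \<open>
  For \<open>\<alpha> i = j\<close> the colour of \<open>j\<close> is unconstrained; otherwise it equals that of \<open>\<alpha> i\<close>.
\<close>

lemma card_colourings_Cons_eq:
  assumes "i \<notin> set ys" "j \<notin> set ys" "i \<noteq> j" "\<alpha> ` insert i (insert j (set ys)) \<subseteq> insert i (insert j (set ys))"
    and "inj_on \<alpha> (insert i (insert j (set ys)))"
    and "\<alpha> i = j"
  shows "card (colourings N \<alpha> i (j # ys)) = N * card (colourings N (contract \<alpha> i j) i ys)"
proof -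
  let ?S = "insert i (set ys)"
  have jS: "j \<notin> ?S" using assms by auto
  \<comment> \<open>By injectivity \<open>i\<close> is the only preimage of \<open>j\<close>, so the
    part of the walk after \<open>j\<close> never reads the colour of \<open>j\<close>.\<close>
  have ne: "\<alpha> j \<noteq> j" "\<And>x. x \<in> set ys \<Longrightarrow> \<alpha> x \<noteq> j"
    using assms by (auto simp: inj_on_def)
  have w: "walk f \<alpha> (f (\<alpha> j)) i ys = walk f' (contract \<alpha> i j) (f' (contract \<alpha> i j i)) i ys"
    if "\<And>x. x \<in> ?S \<Longrightarrow> f x = f' x" for f f' :: "'a \<Rightarrow> nat"
  proof -
    have "f (\<alpha> j) = f' (contract \<alpha> i j i)"
      using ne assms(4) that by (auto simp: contract_def Let_def)
    moreover have "f y = f' y \<and> f (\<alpha> y) = f' (contract \<alpha> i j y)" if "y \<in> set ys" for y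
    proof -
      have "y \<noteq> i" "\<alpha> y \<noteq> j" "\<alpha> y \<in> ?S" using ne assms(1,4) that by auto
      then show ?thesis using that \<open>\<And>x. x \<in> ?S \<Longrightarrow> f x = f' x\<close> by (simp add: contract_def Let_def)
    qed
    ultimately show ?thesis using that by (simp add: walk_cong[of ys f f' \<alpha> "contract \<alpha> i j"])
  qed
  have "bij_betw (\<lambda>f. (f j, restrict f ?S)) (colourings N \<alpha> i (j # ys))
          ({..<N} \<times> colourings N (contract \<alpha> i j) i ys)"
  proof (rule bij_betwI[where g = "\<lambda>(c, f). f(j := c)"])
    show "(\<lambda>f. (f j, restrict f ?S)) \<in> colourings N \<alpha> i (j # ys) \<rightarrow> {..<N} \<times> colourings N (contract \<alpha> i j) i ys"
    proof
      fix f assume f: "f \<in> colourings N \<alpha> i (j # ys)"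
      then have "walk f \<alpha> (f (\<alpha> j)) i ys" by (auto simp: colourings_def)
      then have "walk (restrict f ?S) (contract \<alpha> i j) (restrict f ?S (contract \<alpha> i j i)) i ys"
        by (subst w[symmetric, of f]) auto
      then show "(f j, restrict f ?S) \<in> {..<N} \<times> colourings N (contract \<alpha> i j) i ys"
        using f by (auto simp: colourings_def PiE_iff)
    qed
    show "(\<lambda>(c, f). f(j := c)) \<in> {..<N} \<times> colourings N (contract \<alpha> i j) i ys \<rightarrow> colourings N \<alpha> i (j # ys)"
    proof (clarify)
      fix c f assume c: "c < N" and f: "f \<in> colourings N (contract \<alpha> i j) i ys"
      then have "walk f (contract \<alpha> i j) (f (contract \<alpha> i j i)) i ys" by (auto simp: colourings_def)
      then have "walk (f(j := c)) \<alpha> ((f(j := c)) (\<alpha> j)) i ys"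
        using jS by (subst w[of _ f]) auto
      then show "f(j := c) \<in> colourings N \<alpha> i (j # ys)"
        using f c assms(6) by (auto simp: colourings_def PiE_iff extensional_def)
    qed
    show "(case (f j, restrict f ?S) of (c, f) \<Rightarrow> f(j := c)) = f" if "f \<in> colourings N \<alpha> i (j # ys)" for f
      using that by (auto simp: colourings_def PiE_iff extensional_def fun_eq_iff)
    show "(\<lambda>f. (f j, restrict f ?S)) (case y of (c, f) \<Rightarrow> f(j := c)) = y"
      if "y \<in> {..<N} \<times> colourings N (contract \<alpha> i j) i ys" for y
      using that jS by (cases y) (auto simp: colourings_def PiE_iff extensional_def fun_eq_iff)
  qed
  then show ?thesis
    by (auto dest!: bij_betw_same_card simp: card_cartesian_product)
qed

lemma card_colourings_Cons_neq:
  assumes "i \<notin> set ys" "j \<notin> set ys" "i \<noteq> j" "\<alpha> ` insert i (insert j (set ys)) \<subseteq> insert i (insert j (set ys))"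
    and "\<alpha> i \<noteq> j"
  shows "card (colourings N \<alpha> i (j # ys)) = card (colourings N (contract \<alpha> i j) i ys)"
proof -
  let ?S = "insert i (set ys)"
  have jS: "j \<notin> ?S" and aS: "\<alpha> i \<in> ?S" using assms by auto
  have w: "walk f \<alpha> (f (\<alpha> j)) i ys = walk f' (contract \<alpha> i j) (f' (contract \<alpha> i j i)) i ys"
    if eq: "\<And>x. x \<in> ?S \<Longrightarrow> f x = f' x" and fj: "f j = f (\<alpha> i)" for f f' :: "'a \<Rightarrow> nat"
  proof -
    have "\<alpha> j \<in> insert j ?S" using assms(4) by auto
    then have "f (\<alpha> j) = f' (contract \<alpha> i j i)"
      using eq fj aS by (auto simp: contract_def Let_def)
    moreover have "f y = f' y \<and> f (\<alpha> y) = f' (contract \<alpha> i j y)" if "y \<in> set ys" for y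
    proof -
      have "y \<noteq> i" "\<alpha> y \<in> insert j ?S" using assms(1,4) that by auto
      then show ?thesis using that eq fj aS by (auto simp: contract_def Let_def)
    qed
    ultimately show ?thesis using eq by (simp add: walk_cong[of ys f f' \<alpha> "contract \<alpha> i j"])
  qed
  have "bij_betw (\<lambda>f. restrict f ?S) (colourings N \<alpha> i (j # ys)) (colourings N (contract \<alpha> i j) i ys)"
  proof (rule bij_betwI[where g = "\<lambda>f. f(j := f (\<alpha> i))"])
    show "(\<lambda>f. restrict f ?S) \<in> colourings N \<alpha> i (j # ys) \<rightarrow> colourings N (contract \<alpha> i j) i ys"
    proof
      fix f assume f: "f \<in> colourings N \<alpha> i (j # ys)"
      then have "walk f \<alpha> (f (\<alpha> j)) i ys" "f j = f (\<alpha> i)" by (auto simp: colourings_def)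
      then have "walk (restrict f ?S) (contract \<alpha> i j) (restrict f ?S (contract \<alpha> i j i)) i ys"
        by (subst w[symmetric, of f]) auto
      then show "restrict f ?S \<in> colourings N (contract \<alpha> i j) i ys"
        using f by (auto simp: colourings_def PiE_iff)
    qed
    show "(\<lambda>f. f(j := f (\<alpha> i))) \<in> colourings N (contract \<alpha> i j) i ys \<rightarrow> colourings N \<alpha> i (j # ys)"
    proof
      fix f assume f: "f \<in> colourings N (contract \<alpha> i j) i ys"
      then have "walk f (contract \<alpha> i j) (f (contract \<alpha> i j i)) i ys" by (auto simp: colourings_def)
      then have "walk (f(j := f (\<alpha> i))) \<alpha> ((f(j := f (\<alpha> i))) (\<alpha> j)) i ys"
        using jS assms(5) by (subst w[of _ f]) auto
      then show "f(j := f (\<alpha> i)) \<in> colourings N \<alpha> i (j # ys)"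
        using f aS assms(5) by (auto simp: colourings_def PiE_iff extensional_def)
    qed
    show "(restrict f ?S)(j := restrict f ?S (\<alpha> i)) = f" if "f \<in> colourings N \<alpha> i (j # ys)" for f
      using that aS by (auto simp: colourings_def PiE_iff extensional_def fun_eq_iff)
    show "restrict (f(j := f (\<alpha> i))) ?S = f"
      if "f \<in> colourings N (contract \<alpha> i j) i ys" for f
      using that jS by (auto simp: colourings_def PiE_iff extensional_def fun_eq_iff)
  qed
  then show ?thesis by (rule bij_betw_same_card)
qed

text \<open>For \<open>i\<close> in \<open>S\<close>, every long cycle on \<open>S\<close> is
  written exactly once as \<open>i # ys\<close>, so this counts pairs of a long cycle and a
  compatible colouring.\<close>

definition total :: "nat \<Rightarrow> ('a \<Rightarrow> 'a) \<Rightarrow> 'a \<Rightarrow> 'a set \<Rightarrow> nat" where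
  "total N \<alpha> i S = (\<Sum>ys\<in>permutations_of_set (S - {i}). card (colourings N \<alpha> i ys))"

lemma total_singleton:
  assumes "\<alpha> i = i"
  shows "total N \<alpha> i {i} = N"
proof -
  have "colourings N \<alpha> i [] = {i} \<rightarrow>\<^sub>E {..<N}"
    using assms by (auto simp: colourings_def)
  then show ?thesis by (simp add: total_def card_PiE)
qed

text \<open>The long cycles are grouped by the successor \<open>j\<close> of \<open>i\<close>, which
  is then deleted. The factor \<open>N\<close> is the free choice of the colour of \<open>j\<close>
  when \<open>j = \<alpha> i\<close>.\<close>

lemma total_rec:
  assumes "finite S" "i \<in> S" "\<alpha> ` S \<subseteq> S" "inj_on \<alpha> S" "S \<noteq> {i}"
  shows "total N \<alpha> i S = (\<Sum>j\<in>S - {i}. (if j = \<alpha> i then N else 1) * total N (contract \<alpha> i j) i (S - {j}))"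
proof -
  let ?T = "S - {i}"
  have "permutations_of_set ?T = (\<Union>j\<in>?T. (#) j ` permutations_of_set (?T - {j}))"
    using assms by (intro permutations_of_set_nonempty) auto
  then have "total N \<alpha> i S = (\<Sum>ys\<in>(\<Union>j\<in>?T. (#) j ` permutations_of_set (?T - {j})). card (colourings N \<alpha> i ys))"
    by (simp add: total_def)
  also have "\<dots> = (\<Sum>j\<in>?T. \<Sum>ys\<in>(#) j ` permutations_of_set (?T - {j}). card (colourings N \<alpha> i ys))"
    using assms(1) by (intro sum.UNION_disjoint) auto
  also have "\<dots> = (\<Sum>j\<in>?T. \<Sum>ys\<in>permutations_of_set (?T - {j}). card (colourings N \<alpha> i (j # ys)))"
    by (rule sum.cong[OF refl]) (subst sum.reindex, auto)
  also have "\<dots> = (\<Sum>j\<in>?T. \<Sum>ys\<in>permutations_of_set (?T - {j}).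
      (if j = \<alpha> i then N else 1) * card (colourings N (contract \<alpha> i j) i ys))"
  proof (intro sum.cong refl)
    fix j ys assume j: "j \<in> ?T" and ys: "ys \<in> permutations_of_set (?T - {j})"
    then have S: "insert i (insert j (set ys)) = S" "i \<notin> set ys" "j \<notin> set ys" "i \<noteq> j"
      using assms(2) by (auto dest: permutations_of_setD)
    show "card (colourings N \<alpha> i (j # ys)) = (if j = \<alpha> i then N else 1) * card (colourings N (contract \<alpha> i j) i ys)"
      using card_colourings_Cons_eq[of i ys j \<alpha> N] card_colourings_Cons_neq[of i ys j \<alpha> N] S assms(3,4)
      by auto
  qed
  also have "\<dots> = (\<Sum>j\<in>?T. (if j = \<alpha> i then N else 1) * total N (contract \<alpha> i j) i (S - {j}))"
    unfolding total_def sum_distrib_left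
    by (intro sum.cong refl) (auto simp: insert_commute Diff_insert[symmetric])
  finally show ?thesis .
qed

subsection \<open>The generating function\<close>

definition V :: "nat \<Rightarrow> complex fps" where
  "V m = inverse (1 - fps_X) ^ m"

lemma V_Suc: "(1 - fps_X) * V (Suc m) = V m"
proof -
  have "(1 - fps_X) * inverse (1 - fps_X) = (1 :: complex fps)"
    by (simp add: inverse_mult_eq_1')
  then show ?thesis by (simp add: V_def mult.assoc[symmetric])
qed

lemma fps_deriv_V: "fps_deriv (V m) = of_nat m * V (Suc m)"
proof (induction m)
  case (Suc m)
  have "fps_deriv (inverse (1 - fps_X :: complex fps)) = inverse (1 - fps_X) ^ 2"
    by (subst fps_inverse_deriv) auto
  moreover have "V (Suc m) = inverse (1 - fps_X) * V m" "V (Suc (Suc m)) = inverse (1 - fps_X) ^ 2 * V m" for m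
    by (simp_all add: V_def power2_eq_square)
  ultimately show ?case
    using Suc by (simp add: algebra_simps power2_eq_square)
qed (simp add: V_def)

text \<open>The factor \<open>N\<close> for a free colour becomes the Euler operator
  \<open>x d/dx\<close> on generating functions.\<close>

lemma fps_nth_X_mult_deriv: "fps_nth (fps_X * fps_deriv F) N = of_nat N * fps_nth F N"
  for F :: "complex fps"
  by (cases N) auto

definition wt :: "nat \<Rightarrow> complex fps" where
  "wt a = 1 - fps_X ^ a"

definition wprod :: "nat list \<Rightarrow> complex fps" where
  "wprod ls = prod_list (map wt ls)"

lemma wprod_simps [simp]:
  "wprod [] = 1" "wprod (a # ls) = wt a * wprod ls" "wprod (ls @ ls') = wprod ls * wprod ls'"
  by (simp_all add: wprod_def)

lemma wt_0 [simp]: "wt 0 = 0"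
  by (simp add: wt_def)

text \<open>
  \<open>joinsum e ls\<close> collects the products obtained by joining a cycle of length \<open>e + 1\<close> with one of the
  cycles of lengths \<open>ls\<close> and removing one point, one summand for each choice of that point.
\<close>

fun joinsum :: "nat \<Rightarrow> nat list \<Rightarrow> complex fps" where
  "joinsum e [] = 0"
| "joinsum e (b # ls) = of_nat b * wt (e + b) * wprod ls + wt b * joinsum e ls"

lemma X_mult_deriv_wt: "fps_X * fps_deriv (wt a) = - of_nat a * fps_X ^ a"
proof (induction a)
  case (Suc a)
  have "wt (Suc a) = wt 1 + fps_X * wt a"
    by (simp add: wt_def algebra_simps)
  then have "fps_X * fps_deriv (wt (Suc a)) = fps_X * fps_deriv (wt 1) + fps_X * wt a + fps_X * (fps_X * fps_deriv (wt a))"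
    by (simp add: algebra_simps)
  then show ?case
    unfolding Suc by (simp add: wt_def algebra_simps)
qed simp

text \<open>The Euler operator acts on one factor at a time and turns \<open>wt b\<close> into
  \<open>- b x^b\<close>; the identity \<open>wt (e + b) - wt e * x^b = wt b\<close> then restores
  the full product. This trades the joining terms for a derivative of
  \<open>wprod ls\<close>.\<close>

lemma joinsum_eq:
  "joinsum e ls + wt e * (fps_X * fps_deriv (wprod ls)) = of_nat (sum_list ls) * wprod ls"
proof (induction ls)
  case (Cons b ls)
  have "joinsum e (b # ls) + wt e * (fps_X * fps_deriv (wprod (b # ls)))
     = of_nat b * wt (e + b) * wprod ls + wt e * (fps_X * fps_deriv (wt b)) * wprod ls
       + wt b * (joinsum e ls + wt e * (fps_X * fps_deriv (wprod ls)))"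
    by (simp add: algebra_simps)
  also have "\<dots> = of_nat b * (wt (e + b) - wt e * fps_X ^ b) * wprod ls + wt b * (of_nat (sum_list ls) * wprod ls)"
    unfolding Cons X_mult_deriv_wt by (simp add: algebra_simps)
  also have "wt (e + b) - wt e * fps_X ^ b = wt b"
    by (simp add: wt_def power_add algebra_simps)
  finally show ?case by (simp add: algebra_simps)
qed simp

text \<open>Each summand expands to \<open>1 + x^e - x^k - x^(e - k)\<close>. The reflection of
  \<open>k\<close> to \<open>e - k\<close> merges the last two sums into twice a geometric sum,
  which telescopes against \<open>1 - x\<close>.\<close>

lemma splitsum_eq:
  assumes "e \<ge> 1"
  shows "(1 - fps_X) * (\<Sum>k=1..<e. wt k * wt (e - k)) =
    of_nat (e - 1) * (1 + fps_X ^ e) * (1 - fps_X) - 2 * (fps_X - fps_X ^ e)"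
proof -
  have geo: "(1 - fps_X) * (\<Sum>k=1..<e. fps_X ^ k) = fps_X - (fps_X :: complex fps) ^ e"
    using assms
  proof (induction e rule: dec_induct)
    case (step n)
    then have "(1 - fps_X) * (\<Sum>k=1..<Suc n. (fps_X :: complex fps) ^ k)
        = (1 - fps_X) * (\<Sum>k=1..<n. fps_X ^ k) + (1 - fps_X) * fps_X ^ n"
      using step.hyps by (simp add: distrib_left)
    then show ?case
      unfolding step.IH by (simp add: algebra_simps)
  qed simp
  have "(\<Sum>k=1..<e. fps_X ^ (e - k)) = (\<Sum>k=1..<e. (fps_X :: complex fps) ^ k)"
    by (rule sum.reindex_bij_witness[of _ "\<lambda>k. e - k" "\<lambda>k. e - k"]) auto
  moreover have "wt k * wt (e - k) = 1 + fps_X ^ e - fps_X ^ k - fps_X ^ (e - k)" if "k \<in> {1..<e}" for k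
  proof -
    have "fps_X ^ e = fps_X ^ k * (fps_X ^ (e - k) :: complex fps)"
      using that by (simp flip: power_add)
    then show ?thesis by (simp add: wt_def algebra_simps)
  qed
  ultimately have eq: "(\<Sum>k=1..<e. wt k * wt (e - k)) = of_nat (e - 1) * (1 + fps_X ^ e) - 2 * (\<Sum>k=1..<e. fps_X ^ k)"
    by (simp add: sum_subtractf)
  have "(1 - fps_X) * (\<Sum>k=1..<e. wt k * wt (e - k))
      = of_nat (e - 1) * (1 + fps_X ^ e) * (1 - fps_X) - 2 * ((1 - fps_X) * (\<Sum>k=1..<e. fps_X ^ k))"
    unfolding eq by (simp only: right_diff_distrib mult_ac)
  then show ?thesis
    unfolding geo .
qed

text \<open>The counterpart of \<open>total_rec\<close> when the cycle of \<open>i\<close> has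
  length \<open>e + 1\<close> and the others have lengths \<open>ls\<close>: the derivative stands
  for \<open>j = \<alpha> i\<close>, the sum over \<open>k\<close> for the other \<open>j\<close> in
  the cycle of \<open>i\<close>, and \<open>joinsum\<close> for \<open>j\<close> in a different
  cycle.\<close>

lemma wprod_rec:
  assumes "m = Suc (e + sum_list ls)"
  shows "of_nat (m - 1) * (fps_X * (wt (Suc e) * wprod ls) * V (m + 2)) =
     fps_X * fps_deriv (fps_X * (wt e * wprod ls) * V (m + 1))
     + fps_X * ((\<Sum>k=1..<e. wt k * wt (e - k)) * wprod ls) * V (m + 1)
     + fps_X * joinsum e ls * V (m + 1)"
proof -
  define U where "U = V (m + 2)"
  define S where "S = (\<Sum>k=1..<e. wt k * wt (e - k))"
  have VU: "V (m + 1) = (1 - fps_X) * U" "fps_deriv (V (m + 1)) = of_nat (m + 1) * U"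
    using V_Suc[of "m + 1"] fps_deriv_V[of "m + 1"] by (simp_all add: U_def)
  have J: "joinsum e ls = of_nat (sum_list ls) * wprod ls - wt e * (fps_X * fps_deriv (wprod ls))"
    using joinsum_eq[of e ls] by (simp add: algebra_simps)
  \<comment> \<open>The derivatives of \<open>wprod ls\<close> cancel by \<open>J\<close>; once
    \<open>fps_X * wprod ls * U\<close> is factored out, this identity is all that remains.\<close>
  have S: "(1 - fps_X) * S + (1 - fps_X) * wt e - (1 - fps_X) * (of_nat e * fps_X ^ e)
      + of_nat (m + 1) * fps_X * wt e + (1 - fps_X) * of_nat (sum_list ls) = of_nat (m - 1) * wt (Suc e)"
  proof (cases "e = 0")
    case True
    then show ?thesis using assms by (simp add: S_def wt_def mult.commute)
  next
    case False
    then obtain d where d: "e = Suc d" by (cases e) auto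
    have "(1 - fps_X) * S = of_nat d * (1 + fps_X ^ e) * (1 - fps_X) - 2 * (fps_X - fps_X ^ e)"
      using splitsum_eq[of e] by (simp add: S_def d)
    then show ?thesis
      unfolding assms by (simp add: wt_def algebra_simps d)
  qed
  have "fps_X * fps_deriv (fps_X * (wt e * wprod ls) * V (m + 1)) + fps_X * (S * wprod ls) * V (m + 1)
      + fps_X * joinsum e ls * V (m + 1)
    = fps_X * (wt e * wprod ls) * V (m + 1) + fps_X * (fps_X * fps_deriv (wt e)) * wprod ls * V (m + 1)
      + fps_X * wt e * (fps_X * fps_deriv (wprod ls)) * V (m + 1)
      + fps_X * (wt e * wprod ls) * (fps_X * fps_deriv (V (m + 1)))
      + fps_X * (S * wprod ls) * V (m + 1) + fps_X * joinsum e ls * V (m + 1)"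
    by (simp add: algebra_simps)
  also have "\<dots> = fps_X * wprod ls * U * ((1 - fps_X) * S + (1 - fps_X) * wt e - (1 - fps_X) * (of_nat e * fps_X ^ e)
      + of_nat (m + 1) * fps_X * wt e + (1 - fps_X) * of_nat (sum_list ls))"
    unfolding VU(2) J X_mult_deriv_wt unfolding VU(1) by (simp add: algebra_simps)
  also have "\<dots> = of_nat (m - 1) * (fps_X * (wt (Suc e) * wprod ls) * U)"
    unfolding S by (simp only: mult_ac)
  finally show ?thesis by (simp add: S_def U_def)
qed

text \<open>The base case of a single fixed point, with series \<open>x / (1 - x)^2\<close>.\<close>

lemma fps_nth_wprod_single: "fps_nth (fps_X * wprod [1] * V 3) N = of_nat N"
proof -
  have "fps_X * wprod [1] * V 3 = fps_X * ((1 - fps_X) * V (Suc 2))"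
    by (simp add: wt_def numeral_3_eq_3 mult_ac)
  also have "\<dots> = fps_X * fps_deriv (V 1)"
    unfolding V_Suc fps_deriv_V by (simp add: numeral_2_eq_2)
  also have "fps_nth \<dots> N = of_nat N"
    unfolding fps_nth_X_mult_deriv by (simp add: V_def fps_inverse_one_minus_fps_X)
  finally show ?thesis .
qed

subsection \<open>The recursion on cycle types\<close>

text \<open>Each cycle is a list with a chosen starting entry, so that \<open>i\<close> can be put
  at a head and contraction becomes cutting and pasting of lists.\<close>

definition is_cycles :: "('a \<Rightarrow> 'a) \<Rightarrow> 'a list list \<Rightarrow> bool" where
  "is_cycles \<alpha> cs \<longleftrightarrow> distinct (concat cs) \<and> (\<forall>c\<in>set cs. c \<noteq> [] \<and> map \<alpha> c = rotate1 c)"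

lemma is_cycles_image:
  assumes "is_cycles \<alpha> cs"
  shows "\<alpha> ` set (concat cs) = set (concat cs)"
proof -
  have "\<alpha> ` set c = set c" if "c \<in> set cs" for c
    using assms that unfolding is_cycles_def by (metis set_map set_rotate1)
  then show ?thesis by (auto simp: image_UN)
qed

lemma is_cycles_inj_on:
  assumes "is_cycles \<alpha> cs"
  shows "inj_on \<alpha> (set (concat cs))"
  using is_cycles_image[OF assms] by (intro finite_surj_inj) auto

text \<open>Separates reading the image of \<open>j\<close> at \<open>i\<close> from renaming the
  value \<open>j\<close> to \<open>\<alpha> i\<close>; on lists, \<open>contract\<close> is then a
  renaming of images that are already known.\<close>

lemma contract_eq:
  "contract \<alpha> i j x = (id(j := \<alpha> i)) (\<alpha> (if x = i then j else x))"
  by (simp add: contract_def Let_def)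

lemma contract_cycle_other:
  assumes "map \<alpha> c = rotate1 c" "i \<notin> set c" "j \<notin> set c"
  shows "map (contract \<alpha> i j) c = rotate1 c"
proof -
  have "\<alpha> x \<in> set c" if "x \<in> set c" for x
    using assms(1) that by (metis image_eqI set_map set_rotate1)
  then have "map (contract \<alpha> i j) c = map \<alpha> c"
    using assms(2,3) by (intro map_cong) (auto simp: contract_eq)
  then show ?thesis using assms(1) by simp
qed

text \<open>After the deletion \<open>i\<close> continues with \<open>qs\<close>, while the last
  entry of \<open>ps\<close> is redirected from \<open>j\<close> to \<open>\<alpha> i\<close>, the
  head of \<open>ps\<close>, which closes \<open>ps\<close> up. If \<open>ps\<close> is empty, then
  \<open>j = \<alpha> i\<close> and no second cycle arises.\<close>

lemma is_cycles_contract_split: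
  assumes "is_cycles \<alpha> ((i # ps @ j # qs) # rest)"
  shows "is_cycles (contract \<alpha> i j) ((i # qs) # (if ps = [] then rest else ps # rest))"
proof -
  let ?\<beta> = "id(j := \<alpha> i)"
  have dist: "distinct (concat ((i # ps @ j # qs) # rest))"
    and rest: "\<And>c. c \<in> set rest \<Longrightarrow> c \<noteq> [] \<and> map \<alpha> c = rotate1 c"
    using assms by (auto simp: is_cycles_def)
  have "map \<alpha> (i # ps @ j # qs) = (ps @ [j]) @ (qs @ [i])"
    using assms by (simp add: is_cycles_def)
  then have "map \<alpha> (i # ps) @ map \<alpha> (j # qs) = (ps @ [j]) @ (qs @ [i])"
    by simp
  then have 1: "map \<alpha> (i # ps) = ps @ [j]" and 2: "map \<alpha> (j # qs) = qs @ [i]"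
    using iffD1[OF append_eq_append_conv[of "map \<alpha> (i # ps)" "ps @ [j]"]] by simp_all
  have "map (contract \<alpha> i j) (i # qs) = map ?\<beta> (map \<alpha> (j # qs))"
    using dist by (auto simp: contract_eq)
  also have "\<dots> = qs @ [i]"
    unfolding 2 using dist by (auto intro!: map_idI)
  finally have A: "map (contract \<alpha> i j) (i # qs) = rotate1 (i # qs)" by simp
  have B: "map (contract \<alpha> i j) ps = rotate1 ps" if ne: "ps \<noteq> []"
  proof -
    obtain p ps' where ps: "ps = p # ps'" using ne by (cases ps) auto
    have "map (contract \<alpha> i j) ps = map ?\<beta> (map \<alpha> ps)"
      using dist by (auto simp: contract_eq)
    also have "map \<alpha> ps = ps' @ [j]" using 1 ps by simp
    also have "map ?\<beta> (ps' @ [j]) = ps' @ [p]"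
      using 1 dist ps by (auto intro!: map_idI)
    finally show ?thesis using ps by simp
  qed
  have C: "map (contract \<alpha> i j) c = rotate1 c" if "c \<in> set rest" for c
    using rest[OF that] dist that by (intro contract_cycle_other) auto
  show ?thesis
    unfolding is_cycles_def using A B C dist rest by auto
qed

text \<open>Rotated to start at \<open>j\<close>, the second cycle is \<open>j # qs @ ps\<close>.
  Now \<open>i\<close> takes the place of \<open>j\<close>, and the last entry of this list is
  redirected to \<open>\<alpha> i\<close>, where the rest of the first cycle follows.\<close>

lemma is_cycles_contract_join:
  assumes "is_cycles \<alpha> ((i # xs) # us @ (ps @ j # qs) # vs)"
  shows "is_cycles (contract \<alpha> i j) ((i # qs @ ps @ xs) # us @ vs)"
proof -
  let ?\<beta> = "id(j := \<alpha> i)"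
  have dist: "distinct (concat ((i # xs) # us @ (ps @ j # qs) # vs))"
    and rest: "\<And>c. c \<in> set (us @ vs) \<Longrightarrow> c \<noteq> [] \<and> map \<alpha> c = rotate1 c"
    and 1: "\<alpha> i # map \<alpha> xs = xs @ [i]" and c: "map \<alpha> (ps @ j # qs) = rotate1 (ps @ j # qs)"
    using assms by (auto simp: is_cycles_def)
  have "map \<alpha> (rotate (length ps) (ps @ j # qs)) = rotate1 (rotate (length ps) (ps @ j # qs))"
    using c by (metis rotate1_rotate_swap rotate_map)
  then have 2: "map \<alpha> (j # qs @ ps) = qs @ ps @ [j]"
    by (simp add: rotate_append)
  have "map (contract \<alpha> i j) (i # qs @ ps @ xs) = map ?\<beta> (map \<alpha> (j # qs @ ps)) @ map ?\<beta> (map \<alpha> xs)"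
    using dist by (auto simp: contract_eq)
  also have "map ?\<beta> (map \<alpha> (j # qs @ ps)) = qs @ ps @ [\<alpha> i]"
    unfolding 2 using dist by (auto intro!: map_idI)
  also have "map ?\<beta> (map \<alpha> xs) = map \<alpha> xs"
  proof (rule map_idI)
    fix y assume "y \<in> set (map \<alpha> xs)"
    then have "y \<in> set (xs @ [i])" using 1 by (metis list.set_intros(2))
    then show "?\<beta> y = y" using dist by auto
  qed
  finally have A: "map (contract \<alpha> i j) (i # qs @ ps @ xs) = rotate1 (i # qs @ ps @ xs)"
    using 1 by simp
  have C: "map (contract \<alpha> i j) c = rotate1 c" if "c \<in> set (us @ vs)" for c
    using rest[OF that] dist that by (intro contract_cycle_other) auto
  show ?thesis
    unfolding is_cycles_def using A C dist rest by auto
qed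

text \<open>Follows the recursion of \<open>joinsum\<close>; \<open>K\<close> is arbitrary because
  it absorbs the factors \<open>wt\<close> of the cycles already passed.\<close>

lemma sum_joinsum:
  assumes "distinct (concat cs)"
    and "\<And>us c vs j. cs = us @ c # vs \<Longrightarrow> j \<in> set c \<Longrightarrow>
      t j = fps_nth (K * (wt (e + length c) * wprod (map length (us @ vs)))) N"
  shows "(\<Sum>j\<in>set (concat cs). t j) = fps_nth (K * joinsum e (map length cs)) N"
  using assms
proof (induction cs arbitrary: K)
  case (Cons c cs)
  have "(\<Sum>j\<in>set (concat (c # cs)). t j) = (\<Sum>j\<in>set c. t j) + (\<Sum>j\<in>set (concat cs). t j)"
    using Cons.prems(1) by (simp add: sum.union_disjoint)
  also have "(\<Sum>j\<in>set c. t j) = of_nat (length c) * fps_nth (K * (wt (e + length c) * wprod (map length cs))) N"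
    using Cons.prems(1) Cons.prems(2)[of "[]" c cs] by (simp add: distinct_card)
  also have "\<dots> = fps_nth (of_nat (length c) * (K * (wt (e + length c) * wprod (map length cs)))) N"
    by (simp flip: fps_of_nat)
  also have "(\<Sum>j\<in>set (concat cs). t j) = fps_nth (K * wt (length c) * joinsum e (map length cs)) N"
  proof (rule Cons.IH)
    fix us b vs j assume "cs = us @ b # vs" "j \<in> set b"
    then show "t j = fps_nth (K * wt (length c) * (wt (e + length b) * wprod (map length (us @ vs)))) N"
      using Cons.prems(2)[of "c # us" b vs j] by (simp add: mult_ac)
  qed (use Cons.prems(1) in auto)
  finally show ?case by (simp add: algebra_simps)
qed simp

text \<open>Induction on the number of points, with the cycle through \<open>i\<close> listed first:
  \<open>total_rec\<close> supplies the recursion, the two contraction lemmas the new cycle types,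
  and \<open>wprod_rec\<close> shows that the closed form satisfies the same recursion.\<close>

theorem total_eq:
  assumes "is_cycles \<alpha> ((i # xs) # cs)" "m = length (concat ((i # xs) # cs))"
  shows "of_nat (total N \<alpha> i (set (concat ((i # xs) # cs)))) =
    fps_nth (of_nat (fact (m - 1)) * (fps_X * wprod (map length ((i # xs) # cs)) * V (m + 2))) N"
  using assms
proof (induction m arbitrary: \<alpha> xs cs)
  case (Suc m)
  let ?S = "set (concat ((i # xs) # cs))"
  define e where "e = length xs"
  define P where "P = wprod (map length cs)"
  have dist: "distinct (concat ((i # xs) # cs))" and nonempty: "\<And>c. c \<in> set cs \<Longrightarrow> c \<noteq> []"
    and i: "\<alpha> i # map \<alpha> xs = xs @ [i]"
    using Suc.prems(1) by (auto simp: is_cycles_def)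
  have m: "m = e + sum_list (map length cs)"
    using Suc.prems(2) by (simp add: e_def length_concat)
  show ?case
  proof (cases "m = 0")
    case True
    then have "xs = []" "concat cs = []" using Suc.prems(2) by auto
    moreover from this have "cs = []" using nonempty by (cases cs) auto
    ultimately show ?thesis
      using True i fps_nth_wprod_single[of N] total_singleton[of \<alpha> i N] by (simp add: numeral_3_eq_3)
  next
    case False
    define c :: nat where "c = fact (m - 1)"
    define K where "K = of_nat c * (fps_X * V (m + 2))"
    define t :: "'a \<Rightarrow> complex"
      where "t j = of_nat ((if j = \<alpha> i then N else 1) * total N (contract \<alpha> i j) i (?S - {j}))" for j
    have IH: "of_nat (total N \<alpha>' i (?S - {j})) = fps_nth (K * wprod (map length ((i # xs') # cs'))) N"
      if "is_cycles \<alpha>' ((i # xs') # cs')" "set (concat ((i # xs') # cs')) = ?S - {j}" "j \<in> ?S"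
      for \<alpha>' xs' cs' j
    proof -
      have "length (concat ((i # xs') # cs')) = card (?S - {j})"
        using that distinct_card[of "concat ((i # xs') # cs')"] by (simp add: is_cycles_def)
      also have "\<dots> = m"
        using that(3) distinct_card[OF dist] Suc.prems(2) by simp
      finally have "of_nat (total N \<alpha>' i (?S - {j})) =
        fps_nth (of_nat (fact (m - 1)) * (fps_X * wprod (map length ((i # xs') # cs')) * V (m + 2))) N"
        using Suc.IH[of \<alpha>' xs' cs'] that by metis
      then show ?thesis unfolding K_def c_def by (simp only: mult_ac)
    qed
    have "?S \<noteq> {i}"
    proof
      assume "?S = {i}"
      then have "card ?S = 1" by (metis is_singletonI is_singleton_altdef)
      then show False using distinct_card[OF dist] Suc.prems(2) False by simp
    qed
    then have "of_nat (total N \<alpha> i ?S) = (\<Sum>j\<in>?S - {i}. t j)"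
      unfolding t_def of_nat_sum[symmetric]
      using is_cycles_image[OF Suc.prems(1)] is_cycles_inj_on[OF Suc.prems(1)]
      by (intro arg_cong[where f = of_nat] total_rec) auto
    also have "?S - {i} = set xs \<union> set (concat cs)"
      using dist by auto
    also have "(\<Sum>j\<in>\<dots>. t j) = (\<Sum>j\<in>set xs. t j) + (\<Sum>j\<in>set (concat cs). t j)"
      using dist by (intro sum.union_disjoint) auto
    also have "(\<Sum>j\<in>set (concat cs). t j) = fps_nth (K * joinsum e (map length cs)) N"
    proof (rule sum_joinsum)
      fix us b vs j assume cs: "cs = us @ b # vs" and j: "j \<in> set b"
      obtain ps qs where b: "b = ps @ j # qs" using j by (meson split_list)
      \<comment> \<open>Since \<open>\<alpha> i\<close> lies in the cycle of \<open>i\<close>, a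
        point \<open>j\<close> of another cycle carries no factor \<open>N\<close>.\<close>
      have "\<alpha> i \<in> set (xs @ [i])" using i by (metis list.set_intros(1))
      then have "j \<noteq> \<alpha> i" using dist cs j by auto
      then have "t j = of_nat (total N (contract \<alpha> i j) i (?S - {j}))"
        by (simp add: t_def)
      also have "\<dots> = fps_nth (K * wprod (map length ((i # qs @ ps @ xs) # us @ vs))) N"
        using Suc.prems(1) dist unfolding cs b
        by (intro IH[unfolded cs b] is_cycles_contract_join) auto
      finally show "t j = fps_nth (K * (wt (e + length b) * wprod (map length (us @ vs)))) N"
        by (simp add: b e_def add_ac)
    qed (use dist in auto)
    also have "(\<Sum>j\<in>set xs. t j) = (\<Sum>k<e. t (xs ! k))"
      unfolding e_def using dist
      by (intro sum.reindex_bij_betw[symmetric] bij_betw_nth) auto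
    \<comment> \<open>Deleting \<open>xs ! k\<close> leaves cycles of lengths \<open>e - k\<close>
      and \<open>k\<close>. The index \<open>k = 0\<close> is the case
      \<open>j = \<alpha> i\<close>, where only one cycle of length \<open>e\<close> remains and the
      factor \<open>N\<close> becomes the Euler operator.\<close>
    also have "\<dots> = (\<Sum>k<e. fps_nth ((if k = 0 then fps_X * fps_deriv (K * (wt e * P)) else K * (wt k * wt (e - k) * P))) N)"
    proof (rule sum.cong[OF refl])
      fix k assume k: "k \<in> {..<e}"
      let ?ps = "take k xs" and ?qs = "drop (Suc k) xs" and ?j = "xs ! k"
      have xs: "xs = ?ps @ ?j # ?qs" using k by (simp add: e_def id_take_nth_drop)
      have "\<alpha> i = xs ! 0" using i k by (cases xs) (auto simp: e_def)
      moreover have "0 < length xs" "k < length xs" "distinct xs"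
        using k dist by (auto simp: e_def)
      ultimately have j: "?j = \<alpha> i \<longleftrightarrow> k = 0"
        by (simp add: nth_eq_iff_index_eq)
      have "?ps = [] \<longleftrightarrow> k = 0" using k by (auto simp: e_def)
      moreover have "of_nat (total N (contract \<alpha> i ?j) i (?S - {?j})) =
          fps_nth (K * wprod (map length ((i # ?qs) # (if ?ps = [] then cs else ?ps # cs)))) N"
      proof (rule IH)
        have "is_cycles \<alpha> ((i # ?ps @ ?j # ?qs) # cs)" using Suc.prems(1) xs by simp
        then show "is_cycles (contract \<alpha> i ?j) ((i # ?qs) # (if ?ps = [] then cs else ?ps # cs))"
          by (rule is_cycles_contract_split)
        have "distinct (concat ((i # ?ps @ ?j # ?qs) # cs))" using dist xs by simp
        moreover have "?S = set (concat ((i # ?ps @ ?j # ?qs) # cs))" using xs by simp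
        ultimately show "set (concat ((i # ?qs) # (if ?ps = [] then cs else ?ps # cs))) = ?S - {?j}"
          by auto
        show "?j \<in> ?S" using k by (simp add: e_def)
      qed
      moreover have "length (i # ?qs) = e - k" "length ?ps = k"
        using k by (auto simp: e_def)
      ultimately show "t ?j = fps_nth (if k = 0 then fps_X * fps_deriv (K * (wt e * P)) else K * (wt k * wt (e - k) * P)) N"
        unfolding t_def j fps_nth_X_mult_deriv if_distrib[of "\<lambda>F. fps_nth F N"]
        by (simp add: P_def mult_ac)
    qed
    also have "\<dots> = fps_nth (fps_X * fps_deriv (K * (wt e * P)) + K * ((\<Sum>k=1..<e. wt k * wt (e - k)) * P)) N"
    \<comment> \<open>For \<open>e = 0\<close> the left sum is empty and the derivative vanishes
      because \<open>wt 0 = 0\<close>; otherwise the index 0 is split off.\<close>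
    proof (cases e)
      case (Suc d)
      have "{..<e} = insert 0 {1..<e}" using Suc by auto
      then show ?thesis
        by (simp add: sum_distrib_left sum_distrib_right fps_sum_nth)
    qed simp
    also have "\<dots> + fps_nth (K * joinsum e (map length cs)) N
      = fps_nth (of_nat c * (fps_X * fps_deriv (fps_X * (wt e * P) * V (m + 2))
         + fps_X * ((\<Sum>k=1..<e. wt k * wt (e - k)) * P) * V (m + 2)
         + fps_X * joinsum e (map length cs) * V (m + 2))) N"
      unfolding fps_add_nth[symmetric]
      by (rule arg_cong[where f = "\<lambda>F. fps_nth F N"]) (simp add: K_def algebra_simps)
    also have "fps_X * fps_deriv (fps_X * (wt e * P) * V (m + 2))
         + fps_X * ((\<Sum>k=1..<e. wt k * wt (e - k)) * P) * V (m + 2)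
         + fps_X * joinsum e (map length cs) * V (m + 2)
       = of_nat m * (fps_X * (wt (Suc e) * P) * V (m + 3))"
      using wprod_rec[of "Suc m" e "map length cs"] m by (simp add: P_def numeral_3_eq_3)
    also have "of_nat c * (of_nat m * (fps_X * (wt (Suc e) * P) * V (m + 3)))
       = of_nat (fact m) * (fps_X * (wt (Suc e) * P) * V (m + 3))"
      using False by (simp add: c_def fact_reduce[of m] mult_ac)
    finally show ?thesis
      by (simp add: e_def P_def numeral_3_eq_3)
  qed
qed simp

subsection \<open>Fixed-point-free involutions\<close>

lemma ex_is_cycles_involution:
  assumes "finite S" "\<And>x. x \<in> S \<Longrightarrow> \<alpha> x \<in> S \<and> \<alpha> x \<noteq> x \<and> \<alpha> (\<alpha> x) = x"
  shows "\<exists>cs. is_cycles \<alpha> cs \<and> set (concat cs) = S \<and> (\<forall>c\<in>set cs. length c = 2)"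
  using assms
proof (induction S rule: finite_psubset_induct)
  case (psubset S)
  show ?case
  proof (cases "S = {}")
    case True
    then show ?thesis by (intro exI[of _ "[]"]) (simp add: is_cycles_def)
  next
    case False
    then obtain x where x: "x \<in> S" by auto
    let ?T = "S - {x, \<alpha> x}"
    have "\<alpha> y \<in> ?T \<and> \<alpha> y \<noteq> y \<and> \<alpha> (\<alpha> y) = y" if "y \<in> ?T" for y
      using that x psubset.prems by (metis DiffD1 DiffD2 DiffI insertCI insertE singletonD)
    moreover have "?T \<subset> S" using x by auto
    ultimately obtain cs where cs: "is_cycles \<alpha> cs" "set (concat cs) = ?T" "\<forall>c\<in>set cs. length c = 2"
      using psubset.IH[of ?T] by auto
    have "x \<notin> set (concat cs)" "\<alpha> x \<notin> set (concat cs)" using cs(2) by auto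
    then show ?thesis
      using cs x psubset.prems[OF x] by (intro exI[of _ "[x, \<alpha> x] # cs"]) (auto simp: is_cycles_def)
  qed
qed

lemma one_minus_X_power_V: "(1 - fps_X) ^ k * V (k + m) = V m"
proof (induction k)
  case (Suc k)
  have "(1 - fps_X) ^ Suc k * V (Suc k + m) = (1 - fps_X) ^ k * ((1 - fps_X) * V (Suc (k + m)))"
    by (simp add: mult_ac)
  then show ?case unfolding V_Suc Suc .
qed simp

text \<open>The series \<open>x (1 - x^2)^n / (1 - x)^(2n + 2)\<close> belonging to \<open>n\<close>
  cycles of length two, with \<open>(1 - x)^n\<close> cancelled.\<close>

definition hz_fps :: "nat \<Rightarrow> complex fps" where
  "hz_fps n = fps_X * (1 + fps_X) ^ n * V (n + 2)"

lemma total_involution: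
  assumes "finite S" "i \<in> S" "card S = 2 * n"
    and "\<And>x. x \<in> S \<Longrightarrow> \<alpha> x \<in> S \<and> \<alpha> x \<noteq> x \<and> \<alpha> (\<alpha> x) = x"
  shows "of_nat (total N \<alpha> i S) = of_nat (fact (2 * n - 1)) * fps_nth (hz_fps n) N"
proof -
  let ?T = "S - {i, \<alpha> i}"
  have "\<alpha> y \<in> ?T \<and> \<alpha> y \<noteq> y \<and> \<alpha> (\<alpha> y) = y" if "y \<in> ?T" for y
    using that assms(2,4) by (metis DiffD1 DiffD2 DiffI insertCI insertE singletonD)
  then obtain cs where cs: "is_cycles \<alpha> cs" "set (concat cs) = ?T" "\<forall>c\<in>set cs. length c = 2"
    using ex_is_cycles_involution[of ?T \<alpha>] assms(1) by auto
  let ?cs = "[i, \<alpha> i] # cs"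
  have "i \<notin> set (concat cs)" "\<alpha> i \<notin> set (concat cs)" using cs(2) by auto
  then have 1: "is_cycles \<alpha> ?cs"
    using cs(1) assms(4)[OF assms(2)] by (auto simp: is_cycles_def)
  have 2: "set (concat ?cs) = S"
    using cs(2) assms(2) assms(4)[OF assms(2)] by auto
  have 3: "length (concat ?cs) = 2 * n"
    using distinct_card[of "concat ?cs"] 1 assms(3) unfolding 2 is_cycles_def by simp
  have len: "map length ?cs = replicate (length ?cs) 2"
    using cs(3) by (intro replicate_eqI) auto
  have "2 * n = sum_list (map length ?cs)"
    using 3 by (simp only: length_concat)
  also have "\<dots> = length ?cs * 2"
    unfolding len by (simp only: sum_list_replicate mult.commute) simp
  finally have "length ?cs = n" by linarith
  with len have len: "map length ?cs = replicate n 2" by (simp only:)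
  have "wprod (map length ?cs) = wt 2 ^ n"
    unfolding len wprod_def by simp
  also have "wt 2 = (1 + fps_X) * (1 - fps_X)"
    by (simp add: wt_def algebra_simps power2_eq_square)
  finally have "fps_X * wprod (map length ?cs) * V (2 * n + 2)
      = fps_X * ((1 + fps_X) ^ n * (1 - fps_X) ^ n) * V (n + (n + 2))"
    by (simp only: power_mult_distrib mult_2 add.assoc)
  also have "\<dots> = fps_X * (1 + fps_X) ^ n * ((1 - fps_X) ^ n * V (n + (n + 2)))"
    by (simp only: mult.assoc)
  finally have "fps_X * wprod (map length ?cs) * V (2 * n + 2) = hz_fps n"
    by (simp only: one_minus_X_power_V hz_fps_def)
  then show ?thesis
    using total_eq[OF 1 3[symmetric], of N] unfolding 2 by (simp flip: fps_of_nat)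
qed

text \<open>An invariant colouring is constant on orbits, hence the same as a free colouring of the
  set of orbits; \<open>SOME\<close> merely picks a representative of each orbit.\<close>

lemma card_invariant_colourings:
  assumes "finite S" "\<beta> permutes S"
  shows "card {f \<in> S \<rightarrow>\<^sub>E {..<N}. \<forall>k\<in>S. f (\<beta> k) = f k} = N ^ num_cycles \<beta> S"
proof -
  have perm: "permutation \<beta>" using assms by (auto simp: permutation_permutes)
  have sub: "orbit \<beta> x \<subseteq> S" if "x \<in> S" for x
    using assms(2) that by (rule permutes_orbit_subset)
  have const: "f y = f x" if "\<forall>k\<in>S. f (\<beta> k) = f k" "x \<in> S" "y \<in> orbit \<beta> x" for f :: "nat \<Rightarrow> nat" and x y
    using that(3)
  proof induction
    case (step y)
    have "y \<in> S" using step.hyps sub[OF that(2)] by auto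
    then show ?case using step.IH that(1) by simp
  qed (use that in auto)
  have self: "x \<in> orbit \<beta> x" for x using perm by (rule permutation_self_in_orbit)
  let ?O = "orbit \<beta> ` S"
  have "bij_betw (\<lambda>h. \<lambda>k\<in>S. h (orbit \<beta> k)) (?O \<rightarrow>\<^sub>E {..<N}) {f \<in> S \<rightarrow>\<^sub>E {..<N}. \<forall>k\<in>S. f (\<beta> k) = f k}"
  proof (rule bij_betwI[where g = "\<lambda>f. \<lambda>Q\<in>?O. f (SOME x. x \<in> Q)"])
    show "(\<lambda>h. \<lambda>k\<in>S. h (orbit \<beta> k)) \<in> (?O \<rightarrow>\<^sub>E {..<N}) \<rightarrow> {f \<in> S \<rightarrow>\<^sub>E {..<N}. \<forall>k\<in>S. f (\<beta> k) = f k}"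
      using permutes_in_image[OF assms(2)] permutation_orbit_step[OF perm]
      by auto
    have some: "(SOME y. y \<in> orbit \<beta> x) \<in> orbit \<beta> x" for x
      using self by (rule someI)
    show "(\<lambda>f. \<lambda>Q\<in>?O. f (SOME x. x \<in> Q)) \<in> {f \<in> S \<rightarrow>\<^sub>E {..<N}. \<forall>k\<in>S. f (\<beta> k) = f k} \<rightarrow> ?O \<rightarrow>\<^sub>E {..<N}"
      proof
      fix f assume "f \<in> {f \<in> S \<rightarrow>\<^sub>E {..<N}. \<forall>k\<in>S. f (\<beta> k) = f k}"
      moreover have "(SOME y. y \<in> orbit \<beta> x) \<in> S" if "x \<in> S" for x
        using sub[OF that] some by blast
      ultimately show "(\<lambda>Q\<in>?O. f (SOME x. x \<in> Q)) \<in> ?O \<rightarrow>\<^sub>E {..<N}"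
        by (auto simp: PiE_iff)
    qed
    have eq: "orbit \<beta> (SOME y. y \<in> orbit \<beta> x) = orbit \<beta> x" for x
      by (rule orbit_cyclic_eq3[OF cyclic_on_orbit'[OF perm] some])
    show "(\<lambda>Q\<in>?O. (\<lambda>k\<in>S. h (orbit \<beta> k)) (SOME x. x \<in> Q)) = h" if "h \<in> ?O \<rightarrow>\<^sub>E {..<N}" for h
      proof
      fix Q
      show "(\<lambda>Q\<in>?O. (\<lambda>k\<in>S. h (orbit \<beta> k)) (SOME x. x \<in> Q)) Q = h Q"
      proof (cases "Q \<in> ?O")
        case True
        then obtain x where x: "x \<in> S" "Q = orbit \<beta> x" by auto
        then have "(SOME y. y \<in> orbit \<beta> x) \<in> S" using sub some by blast
        then show ?thesis using x eq by simp
      next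
        case False
        then show ?thesis using that by (simp add: PiE_iff extensional_def)
      qed
    qed
    show "(\<lambda>k\<in>S. (\<lambda>Q\<in>?O. f (SOME x. x \<in> Q)) (orbit \<beta> k)) = f"
      if "f \<in> {f \<in> S \<rightarrow>\<^sub>E {..<N}. \<forall>k\<in>S. f (\<beta> k) = f k}" for f
      proof
      fix k
      have "f \<in> S \<rightarrow>\<^sub>E {..<N}" "\<forall>k\<in>S. f (\<beta> k) = f k" using that by auto
      then show "(\<lambda>k\<in>S. (\<lambda>Q\<in>?O. f (SOME x. x \<in> Q)) (orbit \<beta> k)) k = f k"
        using const[of f k "SOME y. y \<in> orbit \<beta> k"] some[of k] by (simp add: PiE_iff extensional_def)
    qed
  qed
  then have "card {f \<in> S \<rightarrow>\<^sub>E {..<N}. \<forall>k\<in>S. f (\<beta> k) = f k} = card (?O \<rightarrow>\<^sub>E {..<N})"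
    by (simp add: bij_betw_same_card)
  also have "\<dots> = N ^ num_cycles \<beta> S"
    using assms(1) by (simp add: card_PiE num_cycles_def)
  finally show ?thesis .
qed

text \<open>For \<open>c = f (\<alpha> e)\<close> this is the condition
  \<open>f \<circ> \<gamma> = f \<circ> \<alpha>\<close>, read entry by entry along the cyclic list
  \<open>e # ys\<close>.\<close>

lemma walk_iff_map: "walk f \<alpha> c e ys \<longleftrightarrow> map f (ys @ [e]) = c # map (\<lambda>y. f (\<alpha> y)) ys"
  by (induction ys arbitrary: c) auto

section \<open>Reduction of an arbitrary long cycle to the standard one\<close>

lemma map_long_cycle:
  "map (long_cycle n) [1..<2 * n + 1] = rotate1 [1..<2 * n + 1]"
  using cyclic_rotation[of "[1..<2 * n + 1]" 1] by (simp add: long_cycle_def)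

lemma long_cycle_permutes: "long_cycle n permutes {1..2 * n}"
  using cycle_permutes[of "[1..<2 * n + 1]"]
  by (simp add: long_cycle_def atLeastLessThanSuc_atLeastAtMost del: upt_Suc)

text \<open>Sends \<open>1, 2, ...\<close> to the successive entries of \<open>1 # ys\<close>, and
  so conjugates the standard long cycle into the one written \<open>1 # ys\<close>.\<close>

definition relabel :: "nat list \<Rightarrow> nat \<Rightarrow> nat" where
  "relabel ys k = (if k \<in> {1..Suc (length ys)} then (1 # ys) ! (k - 1) else k)"

lemma map_relabel: "map (relabel ys) [1..<length ys + 2] = 1 # ys"
  by (rule nth_equalityI) (auto simp: relabel_def simp del: upt_Suc)

lemma relabel_permutes:
  assumes "ys \<in> permutations_of_set ({1..2 * n} - {1})" "n \<ge> 1"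
  shows "relabel ys permutes {1..2 * n}" "length ys = 2 * n - 1"
proof -
  have ys: "distinct (1 # ys)" "set (1 # ys) = {1..2 * n}"
    using permutations_of_setD[OF assms(1)] insert_Diff[of 1 "{1..2 * n}"] assms(2) by simp_all
  have "length (1 # ys) = 2 * n" using distinct_card[OF ys(1)] ys(2) by simp
  then show len: "length ys = 2 * n - 1" by simp
  have "relabel ys ` {1..2 * n} = set (map (relabel ys) [1..<length ys + 2])"
    using len assms(2) by (auto simp del: upt_Suc)
  then have im: "relabel ys ` {1..2 * n} = {1..2 * n}"
    unfolding map_relabel ys(2) .
  then have "bij_betw (relabel ys) {1..2 * n} {1..2 * n}"
    by (simp add: bij_betw_def eq_card_imp_inj_on)
  then show "relabel ys permutes {1..2 * n}"
    using len assms(2) by (intro bij_imp_permutes) (auto simp: relabel_def)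
qed

lemma fpf_involution_onD:
  assumes "fpf_involution_on \<alpha> S"
  shows "\<alpha> permutes S" "\<alpha> (\<alpha> x) = x" "i \<in> S \<Longrightarrow> \<alpha> i \<noteq> i"
proof -
  have "(\<alpha> \<circ> \<alpha>) x = id x" and "\<forall>i\<in>S. \<alpha> i \<noteq> i"
    using assms unfolding fpf_involution_on_def by metis+
  then show "\<alpha> (\<alpha> x) = x" "i \<in> S \<Longrightarrow> \<alpha> i \<noteq> i" by simp_all
qed (use assms in \<open>simp add: fpf_involution_on_def\<close>)

text \<open>Pulled back along \<open>\<pi>\<close>, compatibility reads \<open>f \<circ> \<pi>
  \<circ> \<gamma> = f \<circ> \<alpha> \<circ> \<pi>\<close>. For
  \<open>h = f \<circ> \<alpha> \<circ> \<pi>\<close> and since \<open>\<alpha>\<close> is an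
  involution, this says that \<open>h\<close> is invariant under
  \<open>inv \<pi> \<circ> \<alpha> \<circ> \<pi> \<circ> \<gamma>\<close>.\<close>

lemma card_colourings_eq:
  assumes ys: "ys \<in> permutations_of_set ({1..2 * n} - {1})" and n: "n \<ge> 1"
    and \<alpha>: "fpf_involution_on \<alpha> {1..2 * n}"
  defines "\<pi> \<equiv> relabel ys"
  shows "card (colourings N \<alpha> 1 ys) = N ^ num_cycles (inv \<pi> \<circ> \<alpha> \<circ> \<pi> \<circ> long_cycle n) {1..2 * n}"
proof -
  let ?S = "{1..2 * n}" and ?\<gamma> = "long_cycle n"
  let ?\<beta> = "inv \<pi> \<circ> \<alpha> \<circ> \<pi> \<circ> ?\<gamma>"
  have \<pi>: "\<pi> permutes ?S" and len: "length ys = 2 * n - 1"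
    using relabel_permutes[OF ys n] by (simp_all add: \<pi>_def)
  have \<alpha>': "\<alpha> permutes ?S" "\<And>x. \<alpha> (\<alpha> x) = x"
    using fpf_involution_onD[OF \<alpha>] by auto
  have \<beta>: "?\<beta> permutes ?S"
    by (intro permutes_compose permutes_inv \<pi> \<alpha>' long_cycle_permutes)
  have L: "1 # ys = map \<pi> [1..<2 * n + 1]"
    using map_relabel[of ys] len n by (simp add: \<pi>_def del: upt_Suc)
  have walk: "walk f \<alpha> (f (\<alpha> 1)) 1 ys \<longleftrightarrow> (\<forall>k\<in>?S. f (\<pi> (?\<gamma> k)) = f (\<alpha> (\<pi> k)))" for f :: "nat \<Rightarrow> nat"
  proof -
    have "walk f \<alpha> (f (\<alpha> 1)) 1 ys \<longleftrightarrow> map f (rotate1 (1 # ys)) = map (\<lambda>y. f (\<alpha> y)) (1 # ys)"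
      by (simp add: walk_iff_map)
    also have "\<dots> \<longleftrightarrow> map (\<lambda>k. f (\<pi> (?\<gamma> k))) [1..<2 * n + 1] = map (\<lambda>k. f (\<alpha> (\<pi> k))) [1..<2 * n + 1]"
      unfolding L rotate1_map map_long_cycle[symmetric] by (simp add: o_def del: upt_Suc)
    also have "\<dots> \<longleftrightarrow> (\<forall>k\<in>?S. f (\<pi> (?\<gamma> k)) = f (\<alpha> (\<pi> k)))"
      by (auto simp del: upt_Suc)
    finally show ?thesis .
  qed
  define \<rho> where "\<rho> = \<alpha> \<circ> \<pi>"
  have \<rho>: "\<rho> permutes ?S" unfolding \<rho>_def by (intro permutes_compose \<pi> \<alpha>')
  have \<rho>\<beta>: "\<rho> (?\<beta> k) = \<pi> (?\<gamma> k)" for k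
    using \<alpha>'(2) by (simp add: \<rho>_def permutes_inverses[OF \<pi>])
  have S: "insert 1 (set ys) = ?S"
    using permutations_of_setD[OF ys] insert_Diff[of 1 ?S] n by simp
  have ext: "(\<lambda>k. f (p k)) \<in> ?S \<rightarrow>\<^sub>E {..<N}" if "f \<in> ?S \<rightarrow>\<^sub>E {..<N}" "p permutes ?S" for f p
    using that permutes_in_image[OF that(2)] by (simp add: PiE_iff extensional_def permutes_not_in)
  have "bij_betw (\<lambda>f k. f (\<rho> k)) (colourings N \<alpha> 1 ys) {f \<in> ?S \<rightarrow>\<^sub>E {..<N}. \<forall>k\<in>?S. f (?\<beta> k) = f k}"
  proof (rule bij_betwI[where g = "\<lambda>f k. f (inv \<rho> k)"])
    show "(\<lambda>f k. f (\<rho> k)) \<in> colourings N \<alpha> 1 ys \<rightarrow> {f \<in> ?S \<rightarrow>\<^sub>E {..<N}. \<forall>k\<in>?S. f (?\<beta> k) = f k}"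
    proof
      fix f assume "f \<in> colourings N \<alpha> 1 ys"
      then have f: "f \<in> ?S \<rightarrow>\<^sub>E {..<N}" "\<forall>k\<in>?S. f (\<pi> (?\<gamma> k)) = f (\<alpha> (\<pi> k))"
        unfolding colourings_def S walk by auto
      then show "(\<lambda>k. f (\<rho> k)) \<in> {f \<in> ?S \<rightarrow>\<^sub>E {..<N}. \<forall>k\<in>?S. f (?\<beta> k) = f k}"
        using ext[OF f(1) \<rho>] unfolding mem_Collect_eq \<rho>\<beta> by (simp add: \<rho>_def)
    qed
    show "(\<lambda>f k. f (inv \<rho> k)) \<in> {f \<in> ?S \<rightarrow>\<^sub>E {..<N}. \<forall>k\<in>?S. f (?\<beta> k) = f k} \<rightarrow> colourings N \<alpha> 1 ys"
    proof
      fix f assume "f \<in> {f \<in> ?S \<rightarrow>\<^sub>E {..<N}. \<forall>k\<in>?S. f (?\<beta> k) = f k}"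
      then have f: "f \<in> ?S \<rightarrow>\<^sub>E {..<N}" "\<forall>k\<in>?S. f (?\<beta> k) = f k" by auto
      have "inv \<rho> (\<pi> (?\<gamma> k)) = ?\<beta> k" "inv \<rho> (\<alpha> (\<pi> k)) = k" for k
        using permutes_inverses(2)[OF \<rho>] \<rho>\<beta>[of k] by (metis, metis \<rho>_def comp_apply)
      then show "(\<lambda>k. f (inv \<rho> k)) \<in> colourings N \<alpha> 1 ys"
        using ext[OF f(1) permutes_inv[OF \<rho>]] f(2) unfolding colourings_def S walk by simp
    qed
  qed (simp_all add: permutes_inverses[OF \<rho>])
  then have "card (colourings N \<alpha> 1 ys) = card {f \<in> ?S \<rightarrow>\<^sub>E {..<N}. \<forall>k\<in>?S. f (?\<beta> k) = f k}"
    by (rule bij_betw_same_card)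
  then show ?thesis
    using card_invariant_colourings[OF _ \<beta>] by simp
qed

lemma fpf_involution_conj:
  assumes "fpf_involution_on \<alpha> S" "\<pi> permutes S"
  shows "fpf_involution_on (inv \<pi> \<circ> \<alpha> \<circ> \<pi>) S"
proof -
  have \<alpha>: "\<alpha> permutes S" "\<And>x. \<alpha> (\<alpha> x) = x" "\<And>i. i \<in> S \<Longrightarrow> \<alpha> i \<noteq> i"
    using fpf_involution_onD[OF assms(1)] by auto
  have "inv \<pi> (\<alpha> (\<pi> i)) \<noteq> i" if "i \<in> S" for i
    using \<alpha>(3)[of "\<pi> i"] that permutes_inverses[OF assms(2)] permutes_in_image[OF assms(2)] by metis
  then show ?thesis
    unfolding fpf_involution_on_def using \<alpha> permutes_inverses[OF assms(2)]
    by (auto intro!: permutes_compose permutes_inv assms(2) simp: fun_eq_iff)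
qed

text \<open>Double counting over involutions and long cycles. For a fixed long cycle, conjugation by
  \<open>relabel ys\<close> permutes \<open>I\<close> and leads to the standard cycle; for a fixed
  involution, \<open>total_involution\<close> gives a value independent of it. The common factor
  \<open>(2n - 1)!\<close> cancels.\<close>

theorem sum_num_cycles:
  assumes n: "n \<ge> 1"
  defines "I \<equiv> {\<alpha>. fpf_involution_on \<alpha> {1..2 * n}}"
  shows "of_nat (\<Sum>\<alpha>\<in>I. N ^ num_cycles (\<alpha> \<circ> long_cycle n) {1..2 * n}) = of_nat (card I) * fps_nth (hz_fps n) N"
proof -
  let ?S = "{1..2 * n}"
  let ?P = "permutations_of_set (?S - {1})"
  let ?c = "\<lambda>\<alpha>. N ^ num_cycles (\<alpha> \<circ> long_cycle n) ?S"
  have inner: "(\<Sum>\<alpha>\<in>I. card (colourings N \<alpha> 1 ys)) = (\<Sum>\<alpha>\<in>I. ?c \<alpha>)" if ys: "ys \<in> ?P" for ys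
  proof -
    let ?\<pi> = "relabel ys"
    have \<pi>: "?\<pi> permutes ?S" by (rule relabel_permutes[OF ys n])
    have "bij_betw (\<lambda>\<alpha>. inv ?\<pi> \<circ> \<alpha> \<circ> ?\<pi>) I I"
    proof (rule bij_betwI[where g = "\<lambda>\<alpha>. ?\<pi> \<circ> \<alpha> \<circ> inv ?\<pi>"])
      show "(\<lambda>\<alpha>. inv ?\<pi> \<circ> \<alpha> \<circ> ?\<pi>) \<in> I \<rightarrow> I"
        using fpf_involution_conj[OF _ \<pi>] by (auto simp: I_def)
      show "(\<lambda>\<alpha>. ?\<pi> \<circ> \<alpha> \<circ> inv ?\<pi>) \<in> I \<rightarrow> I"
        using fpf_involution_conj[OF _ permutes_inv[OF \<pi>]] by (auto simp: I_def permutes_inv_inv[OF \<pi>])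
    qed (simp_all add: fun_eq_iff permutes_inverses[OF \<pi>])
    then have "(\<Sum>\<alpha>\<in>I. ?c (inv ?\<pi> \<circ> \<alpha> \<circ> ?\<pi>)) = (\<Sum>\<alpha>\<in>I. ?c \<alpha>)"
      by (rule sum.reindex_bij_betw)
    then show ?thesis
      using card_colourings_eq[OF ys n] by (simp add: I_def)
  qed
  have "of_nat (\<Sum>\<alpha>\<in>I. total N \<alpha> 1 ?S) = (\<Sum>\<alpha>\<in>I. of_nat (fact (2 * n - 1)) * fps_nth (hz_fps n) N)"
    unfolding of_nat_sum
  proof (rule sum.cong[OF refl])
    fix \<alpha> assume "\<alpha> \<in> I"
    then have "\<alpha> permutes ?S" "\<And>x. \<alpha> (\<alpha> x) = x" "\<And>i. i \<in> ?S \<Longrightarrow> \<alpha> i \<noteq> i"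
      using fpf_involution_onD[of \<alpha> ?S] by (simp_all add: I_def)
    then show "of_nat (total N \<alpha> 1 ?S) = of_nat (fact (2 * n - 1)) * fps_nth (hz_fps n) N"
      using n permutes_in_image[of \<alpha> ?S] by (intro total_involution) auto
  qed
  moreover have "(\<Sum>\<alpha>\<in>I. total N \<alpha> 1 ?S) = fact (2 * n - 1) * (\<Sum>\<alpha>\<in>I. ?c \<alpha>)"
  proof -
    have "(\<Sum>\<alpha>\<in>I. total N \<alpha> 1 ?S) = (\<Sum>ys\<in>?P. \<Sum>\<alpha>\<in>I. card (colourings N \<alpha> 1 ys))"
      unfolding total_def by (rule sum.swap)
    also have "\<dots> = (\<Sum>ys\<in>?P. \<Sum>\<alpha>\<in>I. ?c \<alpha>)"
      by (intro sum.cong refl inner)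
    also have "\<dots> = fact (2 * n - 1) * (\<Sum>\<alpha>\<in>I. ?c \<alpha>)"
      using n by simp
    finally show ?thesis .
  qed
  ultimately have "of_nat (fact (2 * n - 1)) * (of_nat (\<Sum>\<alpha>\<in>I. ?c \<alpha>) :: complex)
      = of_nat (fact (2 * n - 1)) * (of_nat (card I) * fps_nth (hz_fps n) N)"
    by (simp only: of_nat_mult[symmetric] sum_constant mult_ac)
  then show ?thesis by simp
qed

subsection \<open>Zeros of the Harer-Zagier polynomials\<close>

text \<open>Interpolates the coefficients of \<open>hz_fps n\<close> as a polynomial in
  \<open>N\<close>. The starting values \<open>x\<close> and \<open>x^2\<close> come from
  \<open>x / (1 - x)^2\<close> and \<open>x (1 + x) / (1 - x)^3\<close>.\<close>

fun hz_poly :: "nat \<Rightarrow> complex poly" where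
  "hz_poly 0 = monom 1 1"
| "hz_poly (Suc 0) = monom 1 2"
| "hz_poly (Suc (Suc n)) = smult (1 / of_nat (n + 3))
     (monom 2 1 * hz_poly (Suc n) + smult (of_nat (n + 1)) (hz_poly n))"

text \<open>All three series are the common factor \<open>F\<close> times a quadratic polynomial in
  \<open>x\<close>, so only an identity between quadratics has to be checked. On coefficients it is
  the recursion of \<open>hz_poly\<close>.\<close>

lemma hz_fps_rec:
  "of_nat (n + 3) * hz_fps (n + 2)
    = 2 * (fps_X * fps_deriv (hz_fps (n + 1))) + of_nat (n + 1) * hz_fps n"
proof -
  define F where "F = fps_X * (1 + fps_X) ^ n * V (n + 4)"
  have V: "V (n + 2) = (1 - fps_X) ^ 2 * V (n + 4)" "V (n + 3) = (1 - fps_X) * V (n + 4)"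
    using V_Suc[of "n + 3"] one_minus_X_power_V[of 2 "n + 2"] by (simp_all add: eval_nat_numeral)
  have "fps_deriv ((1 + fps_X) ^ Suc n :: complex fps) = of_nat (Suc n) * (1 + fps_X) ^ n"
  proof (induction n)
    case (Suc n)
    have "fps_deriv ((1 + fps_X) ^ Suc (Suc n) :: complex fps)
        = (1 + fps_X) ^ Suc n + (1 + fps_X) * fps_deriv ((1 + fps_X) ^ Suc n)"
      by (subst power_Suc) (simp only: fps_deriv_mult fps_deriv_add fps_deriv_1 fps_deriv_fps_X, simp)
    then show ?case
      unfolding Suc by (simp add: algebra_simps)
  qed simp
  note deriv = this
  have "hz_fps (n + 1) = fps_X * (1 + fps_X) ^ Suc n * V (n + 3)"
    by (simp add: hz_fps_def eval_nat_numeral)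
  then have "fps_deriv (hz_fps (n + 1)) = (1 + fps_X) ^ Suc n * V (n + 3)
      + fps_X * (of_nat (Suc n) * (1 + fps_X) ^ n) * V (n + 3)
      + fps_X * (1 + fps_X) ^ Suc n * (of_nat (n + 3) * V (Suc (n + 3)))"
    by (simp only: fps_deriv_mult deriv fps_deriv_V fps_deriv_fps_X) (simp add: algebra_simps)
  moreover have "Suc (n + 3) = n + 4" by simp
  ultimately have "fps_deriv (hz_fps (n + 1)) = (1 + fps_X) ^ Suc n * V (n + 3)
      + fps_X * (of_nat (Suc n) * (1 + fps_X) ^ n) * V (n + 3)
      + fps_X * (1 + fps_X) ^ Suc n * (of_nat (n + 3) * V (n + 4))"
    by (simp only:)
  then have A: "fps_X * fps_deriv (hz_fps (n + 1)) = F * ((1 + fps_X) * (1 - fps_X)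
      + fps_X * of_nat (Suc n) * (1 - fps_X) + fps_X * (1 + fps_X) * of_nat (n + 3))"
    unfolding F_def V by (simp add: algebra_simps)
  have B: "hz_fps n = F * (1 - fps_X) ^ 2" "hz_fps (n + 2) = F * (1 + fps_X) ^ 2"
    unfolding F_def hz_fps_def V(1) by (simp_all add: power_add mult_ac numeral_eq_Suc)
  show ?thesis
    unfolding A B by (simp add: algebra_simps power2_eq_square)
qed

lemma poly_hz_poly: "poly (hz_poly n) (of_nat N) = fps_nth (hz_fps n) N"
proof (induction n rule: hz_poly.induct)
  case 1
  have "hz_fps 0 = fps_X * fps_deriv (V 1)"
    by (simp add: hz_fps_def fps_deriv_V numeral_2_eq_2)
  then have "fps_nth (hz_fps 0) N = of_nat N * fps_nth (V 1) N"
    by (simp only: fps_nth_X_mult_deriv)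
  then show ?case by (simp add: V_def fps_inverse_one_minus_fps_X poly_monom)
next
  case 2
  have "hz_fps 1 = fps_X * fps_deriv (fps_X * fps_deriv (V 1))"
  proof -
    have "V 2 = (1 - fps_X) * V 3"
      using V_Suc[of 2] by (simp add: eval_nat_numeral)
    moreover have "fps_deriv (V 2) = 2 * V 3" "fps_deriv (V 1) = V 2"
      by (simp_all add: fps_deriv_V eval_nat_numeral)
    ultimately have "fps_X * fps_deriv (fps_X * fps_deriv (V 1)) = fps_X * (1 + fps_X) * V 3"
      by (simp only: fps_deriv_mult fps_deriv_fps_X) (simp add: algebra_simps)
    then show ?thesis by (simp add: hz_fps_def eval_nat_numeral)
  qed
  then have "fps_nth (hz_fps 1) N = of_nat N * (of_nat N * fps_nth (V 1) N)"
    by (simp only: fps_nth_X_mult_deriv)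
  then show ?case by (simp add: V_def fps_inverse_one_minus_fps_X poly_monom power2_eq_square)
next
  case (3 n)
  have nz: "(of_nat (n + 3) :: complex) \<noteq> 0"
    by (simp only: of_nat_eq_0_iff)
  have "of_nat (n + 3) * fps_nth (hz_fps (n + 2)) N
      = fps_nth (of_nat (n + 3) * hz_fps (n + 2)) N"
    by (simp only: fps_of_nat[symmetric] fps_mult_left_const_nth)
  also have "\<dots> = 2 * (of_nat N * fps_nth (hz_fps (n + 1)) N) + of_nat (n + 1) * fps_nth (hz_fps n) N"
    unfolding hz_fps_rec fps_add_nth
    by (simp only: fps_of_nat[symmetric] fps_numeral_fps_const fps_mult_left_const_nth fps_nth_X_mult_deriv)
  finally have "fps_nth (hz_fps (n + 2)) N = (2 * (of_nat N * fps_nth (hz_fps (n + 1)) N) 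
      + of_nat (n + 1) * fps_nth (hz_fps n) N) / of_nat (n + 3)"
    by (simp only: nonzero_eq_divide_eq[OF nz] mult.commute)
  then show ?case
    using 3 by (simp add: poly_monom)
qed

text \<open>Used to exclude exponents in \<open>cycle_poly\<close> that do not belong to any
  genus.\<close>

lemma coeff_hz_poly:
  assumes "coeff (hz_poly n) k \<noteq> 0"
  shows "k \<le> n + 1 \<and> even (n + 1 + k)"
  using assms
proof (induction n arbitrary: k rule: hz_poly.induct)
  case (3 n)
  then have "(k \<noteq> 0 \<and> coeff (hz_poly (Suc n)) (k - 1) \<noteq> 0) \<or> coeff (hz_poly n) k \<noteq> 0"
    by (auto simp: coeff_monom_mult split: if_splits)
  then show ?case
    using "3.IH"(1)[of "k - 1"] "3.IH"(2)[of k] by (cases k) auto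
qed (auto split: if_splits)

text \<open>Divided by its middle term, the recursion takes a ratio \<open>r\<close> to
  \<open>(2 w + (n + 1) / r) / (n + 3)\<close>, and the open right half-plane is closed under
  inversion, addition and positive scaling.\<close>

lemma hz_poly_Re_pos:
  assumes "Re w > 0"
  shows "poly (hz_poly n) w \<noteq> 0 \<and> Re (poly (hz_poly (Suc n)) w / poly (hz_poly n) w) > 0"
proof (induction n)
  case 0
  have "w \<noteq> 0" using assms by auto
  then show ?case using assms by (simp add: poly_monom power2_eq_square)
next
  case (Suc n)
  let ?p = "\<lambda>n. poly (hz_poly n) w"
  define r where "r = ?p (Suc n) / ?p n"
  have r: "Re r > 0" "?p n \<noteq> 0" using Suc by (simp_all add: r_def)
  then have nz: "?p (Suc n) \<noteq> 0" by (auto simp: r_def)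
  have "?p (Suc (Suc n)) / ?p (Suc n) = (2 * w + of_nat (n + 1) * inverse r) / of_nat (n + 3)"
    using nz r(2) by (simp add: r_def poly_monom field_simps)
  also have "\<dots> = complex_of_real (1 / real (n + 3)) * (2 * w + complex_of_real (real (n + 1)) * inverse r)"
    by simp
  finally have eq: "Re (?p (Suc (Suc n)) / ?p (Suc n)) = 1 / real (n + 3) * (2 * Re w + real (n + 1) * Re (inverse r))"
    by (simp only: Re_complex_of_real Im_complex_of_real times_complex.sel plus_complex.sel) simp
  have "Re (inverse r) > 0"
    using r(1) by (simp add: inverse_complex.sel) (simp add: add_pos_nonneg)
  then have "2 * Re w + real (n + 1) * Re (inverse r) > 0"
    using assms by (intro add_pos_pos mult_pos_pos) auto
  then show ?case using nz unfolding eq by simp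
qed

lemma poly_hz_poly_minus: "poly (hz_poly n) (- w) = (-1) ^ (n + 1) * poly (hz_poly n) w"
  by (induction n rule: hz_poly.induct) (simp_all add: poly_monom algebra_simps)

lemma hz_poly_root:
  assumes "poly (hz_poly n) w = 0"
  shows "Re w = 0"
proof (rule ccontr)
  assume "Re w \<noteq> 0"
  then have "Re w > 0 \<or> Re (- w) > 0" by auto
  then show False
    using hz_poly_Re_pos[of w n] hz_poly_Re_pos[of "- w" n] assms by (auto simp: poly_hz_poly_minus)
qed

subsection \<open>Log-concavity from real zeros\<close>

text \<open>
  This form, stronger than \<open>b\<^sub>i b\<^sub>i\<^sub>+\<^sub>2 \<le> (b\<^sub>i\<^sub>+\<^sub>1)\<^sup>2\<close> when there are internal zeros, is preserved by
  multiplication with a linear factor.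
\<close>

definition log_concave :: "(nat \<Rightarrow> real) \<Rightarrow> bool" where
  "log_concave b \<longleftrightarrow> (\<forall>k. b k \<ge> 0) \<and> (\<forall>i j. i \<le> j \<longrightarrow> b i * b (j + 2) \<le> b (i + 1) * b (j + 1))"

text \<open>The new sequence lists the coefficients of \<open>x + a\<close> times the generating
  function of \<open>b\<close>. The inequality is compared separately at \<open>a^2\<close>,
  \<open>a\<close> and 1.\<close>

lemma log_concave_linear_factor:
  assumes b: "log_concave b" and a: "a \<ge> 0"
  shows "log_concave (\<lambda>k. a * b k + (case k of 0 \<Rightarrow> 0 | Suc k \<Rightarrow> b k))"
proof -
  define b' where "b' k = (case k of 0 \<Rightarrow> 0 | Suc k \<Rightarrow> b k)" for k
  have nonneg: "b k \<ge> 0" "b' k \<ge> 0" for k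
    using b by (auto simp: log_concave_def b'_def split: nat.split)
  have lc: "b i * b (j + 2) \<le> b (i + 1) * b (j + 1)" if "i \<le> j" for i j
    using b that by (simp add: log_concave_def)
  have lc': "b' i * b (j + 1) \<le> b i * b j" if "i \<le> j" for i j
  proof (cases i)
    case (Suc l)
    then obtain m where "j = Suc m" using Suc \<open>i \<le> j\<close> by (cases j) auto
    then show ?thesis using lc[of l m] Suc that by (simp add: b'_def)
  qed (simp add: b'_def nonneg)
  have main: "(a * b i + b' i) * (a * b (j + 2) + b (j + 1)) \<le> (a * b (i + 1) + b i) * (a * b (j + 1) + b j)"
    if "i \<le> j" for i j
  proof -
    \<comment> \<open>The part linear in \<open>a\<close>: the term
      \<open>a * b i * b (j + 1)\<close> stands on both sides, and what is left is proved by moving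
      the two indices together in two steps.\<close>
    have "b' i * b (j + 2) \<le> b i * b (j + 1)"
      using lc'[of i "j + 1"] that by simp
    also have "\<dots> \<le> b (i + 1) * b j"
    proof (cases "i = j")
      case False
      then obtain m where "j = m + 1" "i \<le> m" using \<open>i \<le> j\<close> by (cases j) auto
      then show ?thesis using lc[of i m] by simp
    qed simp
    finally have "a * (b' i * b (j + 2)) \<le> a * (b (i + 1) * b j)"
      using a by (rule mult_left_mono)
    moreover have "a ^ 2 * (b i * b (j + 2)) \<le> a ^ 2 * (b (i + 1) * b (j + 1))"
      using lc[OF that] by (rule mult_left_mono) simp
    moreover have "b' i * b (j + 1) \<le> b i * b j" using lc'[OF that] .
    ultimately show ?thesis by (simp add: algebra_simps power2_eq_square)
  qed
  have "a * b k + b' k \<ge> 0" for k using nonneg a by simp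
  then have "log_concave (\<lambda>k. a * b k + b' k)"
    unfolding log_concave_def using main by (simp add: b'_def)
  then show ?thesis by (simp add: b'_def)
qed

lemma log_concave_coeff_prod_mset:
  assumes "\<And>z. z \<in># M \<Longrightarrow> z \<in> \<real> \<and> Re z \<le> 0"
  shows "\<exists>b. log_concave b \<and> (\<forall>k. coeff (\<Prod>z\<in>#M. [:- z, 1:]) k = complex_of_real (b k))"
  using assms
proof (induction M)
  case empty
  show ?case
    by (intro exI[of _ "\<lambda>k. if k = 0 then 1 else 0"]) (auto simp: log_concave_def)
next
  case (add z M)
  then obtain b where b: "log_concave b" "\<And>k. coeff (\<Prod>z\<in>#M. [:- z, 1:]) k = complex_of_real (b k)"
    by auto
  have z: "z = complex_of_real (Re z)" "Re z \<le> 0"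
    using add.prems[of z] by (auto simp: complex_is_Real_iff complex_eq_iff)
  have "(\<Prod>z\<in>#add_mset z M. [:- z, 1:]) = [:complex_of_real (- Re z), 1:] * (\<Prod>z\<in>#M. [:- z, 1:])"
    using z(1) by simp
  then have "coeff (\<Prod>z\<in>#add_mset z M. [:- z, 1:]) k
      = complex_of_real (- Re z * b k + (case k of 0 \<Rightarrow> 0 | Suc k \<Rightarrow> b k))" for k
    by (cases k) (simp_all add: b(2))
  then show ?case
    using log_concave_linear_factor[OF b(1), of "- Re z"] z(2) by auto
qed

lemma log_concave_coeff:
  fixes p :: "complex poly"
  assumes "\<And>z. poly p z = 0 \<Longrightarrow> z \<in> \<real> \<and> Re z \<le> 0"
    and "\<And>k. coeff p k = complex_of_real (c k)"
  shows "c k * c (k + 2) \<le> (c (k + 1)) ^ 2"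
proof (cases "p = 0")
  case True
  then have "c k = 0" for k using assms(2)[of k] by simp
  then show ?thesis by simp
next
  case False
  obtain b where b: "log_concave b" "\<And>k. coeff (\<Prod>z\<in>#proots p. [:- z, 1:]) k = complex_of_real (b k)"
    using log_concave_coeff_prod_mset[of "proots p"] assms(1) False by auto
  define l where "l = c (degree p)"
  have "complex_of_real (c k) = complex_of_real (l * b k)" for k
  proof -
    have "complex_of_real (c k) = coeff (smult (lead_coeff p) (\<Prod>z\<in>#proots p. [:- z, 1:])) k"
      unfolding complex_poly_decompose_multiset by (simp add: assms(2))
    then show ?thesis by (simp add: b(2) assms(2) l_def)
  qed
  then have c: "c k = l * b k" for k by (simp only: of_real_eq_iff)
  \<comment> \<open>The leading coefficient enters only through its square, which is
    nonnegative.\<close>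
  have "l ^ 2 * (b k * b (k + 2)) \<le> l ^ 2 * (b (k + 1) * b (k + 1))"
    using b(1) by (intro mult_left_mono) (auto simp: log_concave_def)
  then show ?thesis by (simp add: c power2_eq_square mult_ac)
qed

subsection \<open>The number of rooted one-face maps\<close>

text \<open>The witness swaps \<open>2k - 1\<close> and \<open>2k\<close>. Existence makes the
  constant in \<open>cycle_poly_eq\<close> nonzero, so that zeros carry over.\<close>

lemma ex_fpf_involution: "\<exists>\<alpha>. fpf_involution_on \<alpha> {1..2 * n}"
proof
  let ?\<alpha> = "\<lambda>x. if x \<in> {1..2 * n} then if odd x then x + 1 else x - 1 else x"
  have step: "?\<alpha> x \<in> {1..2 * n} \<and> ?\<alpha> (?\<alpha> x) = x" if x: "x \<in> {1..2 * n}" for x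
  proof (cases "odd x")
    case True
    then have "x + 1 \<in> {1..2 * n}" using x by (cases "x = 2 * n") auto
    then show ?thesis using True x by simp
  next
    case False
    then have "x - 1 \<in> {1..2 * n}" "odd (x - 1)" using x by (cases "x = 1"; auto)+
    then show ?thesis using False x by simp
  qed
  have inv: "?\<alpha> (?\<alpha> x) = x" for x
  proof (cases "x \<in> {1..2 * n}")
    case False
    then show ?thesis by (simp only: if_False)
  qed (use step in blast)
  have "?\<alpha> x \<in> {1..2 * n}" if "x \<in> {1..2 * n}" for x
    using step[OF that] by blast
  then have "?\<alpha> ` {1..2 * n} \<subseteq> {1..2 * n}" by blast
  moreover have "inj_on ?\<alpha> {1..2 * n}"
    by (rule inj_on_inverseI[where g = ?\<alpha>]) (rule inv)
  ultimately have "bij_betw ?\<alpha> {1..2 * n} {1..2 * n}"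
    using endo_inj_surj[of "{1..2 * n}" ?\<alpha>] by (simp only: bij_betw_def finite_atLeastAtMost)
  then have "?\<alpha> permutes {1..2 * n}"
    by (rule bij_imp_permutes) (simp only: if_False)
  moreover have "?\<alpha> \<circ> ?\<alpha> = id"
    by (rule ext) (unfold comp_apply id_apply, rule inv)
  moreover have "\<forall>i\<in>{1..2 * n}. ?\<alpha> i \<noteq> i" by auto
  ultimately show "fpf_involution_on ?\<alpha> {1..2 * n}"
    unfolding fpf_involution_on_def by blast
qed

section \<open>The cycle-counting polynomial and its relation to \<open>H\<close>\<close>

definition cycle_poly :: "nat \<Rightarrow> complex poly" where
  "cycle_poly n = (\<Sum>\<alpha> | fpf_involution_on \<alpha> {1..2 * n}.
     monom 1 (num_cycles (\<alpha> \<circ> long_cycle n) {1..2 * n}))"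

lemma finite_fpf_involutions: "finite {\<alpha>. fpf_involution_on \<alpha> {1..2 * n}}"
  by (rule finite_subset[OF _ finite_permutations[of "{1..2 * n}"]]) (auto simp: fpf_involution_on_def)

text \<open>By \<open>sum_num_cycles\<close> both sides agree at every natural number, hence at
  infinitely many points.\<close>

lemma cycle_poly_eq:
  assumes "n \<ge> 1"
  shows "cycle_poly n = smult (of_nat (card {\<alpha>. fpf_involution_on \<alpha> {1..2 * n}})) (hz_poly n)"
    (is "?p = ?q")
proof -
  have "poly ?p (of_nat N) = poly ?q (of_nat N)" for N
    using sum_num_cycles[OF assms, of N]
    by (simp add: cycle_poly_def poly_sum poly_monom poly_hz_poly)
  then have "range of_nat \<subseteq> {x. poly (?p - ?q) x = 0}" by auto
  moreover have "infinite (range (of_nat :: nat \<Rightarrow> complex))"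
    by (rule range_inj_infinite) (rule inj_of_nat)
  ultimately have "?p - ?q = 0"
    using poly_roots_finite finite_subset by blast
  then show ?thesis by simp
qed

lemma coeff_cycle_poly:
  assumes "n \<ge> 1" "2 * g \<le> n"
  shows "coeff (cycle_poly n) (n + 1 - 2 * g) = of_nat (A n g)"
proof -
  let ?I = "{\<alpha>. fpf_involution_on \<alpha> {1..2 * n}}"
  let ?c = "\<lambda>\<alpha>. num_cycles (\<alpha> \<circ> long_cycle n) {1..2 * n}"
  have "coeff (cycle_poly n) (n + 1 - 2 * g) = of_nat (card {\<alpha> \<in> ?I. ?c \<alpha> = n + 1 - 2 * g})"
    using finite_fpf_involutions by (simp add: cycle_poly_def coeff_sum sum.If_cases Int_def)
  also have "{\<alpha> \<in> ?I. ?c \<alpha> = n + 1 - 2 * g}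
      = {\<alpha>. fpf_involution_on \<alpha> {1..2 * n} \<and> num_cycles (inv \<alpha> \<circ> long_cycle n) {1..2 * n} + 2 * g = n + 1}"
  proof -
    have "inv \<alpha> = \<alpha>" if "fpf_involution_on \<alpha> {1..2 * n}" for \<alpha>
      using that by (auto simp: fpf_involution_on_def intro: inv_unique_comp)
    then show ?thesis using assms(2) by auto
  qed
  finally show ?thesis by (simp add: A_eq_card_involutions[OF assms(1)])
qed

lemma cycle_poly_eq_sum:
  assumes n: "n \<ge> 1"
  shows "cycle_poly n = (\<Sum>g\<le>n div 2. monom (of_nat (A n g)) (n + 1 - 2 * g))"
proof (rule poly_eqI)
  fix k
  have rhs: "coeff (\<Sum>g\<le>n div 2. monom (of_nat (A n g)) (n + 1 - 2 * g)) k
      = (\<Sum>g\<le>n div 2. if n + 1 - 2 * g = k then of_nat (A n g) else 0 :: complex)"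
    by (simp add: coeff_sum)
  show "coeff (cycle_poly n) k = coeff (\<Sum>g\<le>n div 2. monom (of_nat (A n g)) (n + 1 - 2 * g)) k"
  proof (cases "\<exists>g\<le>n div 2. n + 1 - 2 * g = k")
    case True
    then obtain g where g: "g \<le> n div 2" "n + 1 - 2 * g = k" by auto
    have "(\<Sum>g'\<le>n div 2. if n + 1 - 2 * g' = k then of_nat (A n g') else 0 :: complex)
        = (\<Sum>g'\<le>n div 2. if g' = g then of_nat (A n g') else 0)"
      using g by (intro sum.cong) auto
    also have "\<dots> = of_nat (A n g)" using g(1) by simp
    finally show ?thesis
      using coeff_cycle_poly[OF n, of g] g unfolding rhs by simp
  next
    case False
    have "coeff (cycle_poly n) k = 0"
    proof (rule ccontr)
      assume nz: "coeff (cycle_poly n) k \<noteq> 0"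
      then have "coeff (hz_poly n) k \<noteq> 0" by (auto simp: cycle_poly_eq[OF n])
      then have k: "k \<le> n + 1" "even (n + 1 + k)" using coeff_hz_poly by blast+
      \<comment> \<open>For odd \<open>n\<close> the exponent 0 has the right parity but would
        require \<open>2 * g = n + 1\<close>, outside the range of summation. It is excluded because
        there is always at least one cycle.\<close>
      have pos: "num_cycles \<beta> {1..2 * n} = 0 \<longleftrightarrow> False" for \<beta>
        using n by (simp add: num_cycles_def)
      have "coeff (cycle_poly n) 0 = 0"
        by (simp only: cycle_poly_def coeff_sum coeff_monom pos if_False sum.neutral_const)
      then have "k \<noteq> 0" using nz by metis
      obtain g where "n + 1 = k + 2 * g"
      proof -
        have "even (n + 1 - k)" using k by auto
        then obtain g where "n + 1 - k = 2 * g" by (elim evenE)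
        then show thesis using k(1) by (intro that[of g]) linarith
      qed
      then have "g \<le> n div 2" "n + 1 - 2 * g = k" using \<open>k \<noteq> 0\<close> by auto
      then show False using False by blast
    qed
    then show ?thesis using False unfolding rhs by (auto intro!: sum.neutral[symmetric])
  qed
qed

lemma poly_cycle_poly_eq_H:
  assumes "n \<ge> 1"
  shows "poly (cycle_poly n) w = w ^ ((n + 1) mod 2) * poly (H n) (w ^ 2)"
proof -
  have "w ^ (n + 1 - 2 * g) = w ^ ((n + 1) mod 2) * (w ^ 2) ^ ((n + 1) div 2 - g)" if "g \<le> n div 2" for g
  proof -
    have "(n + 1) mod 2 + 2 * ((n + 1) div 2 - g) = n + 1 - 2 * g"
      using that by presburger
    then show ?thesis by (simp flip: power_mult power_add)
  qed
  then show ?thesis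
    unfolding cycle_poly_eq_sum[OF assms] H_def
    by (simp add: poly_sum poly_monom sum_distrib_left mult_ac)
qed

text \<open>A square root \<open>w\<close> of \<open>z\<close> is a zero of
  \<open>hz_poly n\<close>, hence purely imaginary, and its square is
  \<open>- (Im w)^2\<close>.\<close>

lemma H_root:
  assumes "n \<ge> 1" "poly (H n) z = 0"
  shows "z \<in> \<real> \<and> Re z \<le> 0"
proof -
  define w where "w = csqrt z"
  have w: "w ^ 2 = z" by (simp add: w_def)
  have "poly (cycle_poly n) w = 0"
    using poly_cycle_poly_eq_H[OF assms(1), of w] assms(2) by (simp add: w)
  moreover have "card {\<alpha>. fpf_involution_on \<alpha> {1..2 * n}} \<noteq> 0"
    using ex_fpf_involution[of n] finite_fpf_involutions[of n] by auto
  ultimately have "poly (hz_poly n) w = 0"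
    by (simp add: cycle_poly_eq[OF assms(1)])
  then have "Re w = 0" by (rule hz_poly_root)
  then have "z = complex_of_real (- (Im w)\<^sup>2)"
    unfolding w[symmetric] by (simp add: complex_eq_iff power2_eq_square)
  then show ?thesis by simp
qed

lemma coeff_H:
  assumes "g \<le> n div 2"
  shows "coeff (H n) ((n + 1) div 2 - g) = of_nat (A n g)"
proof -
  have "(n + 1) div 2 - g' = (n + 1) div 2 - g \<longleftrightarrow> g' = g" if "g' \<le> n div 2" for g'
    using that assms by (auto simp: div_le_mono)
  then have "coeff (H n) ((n + 1) div 2 - g) = (\<Sum>g'\<le>n div 2. if g' = g then of_nat (A n g') else 0)"
    unfolding H_def coeff_sum by (intro sum.cong) auto
  then show ?thesis using assms by simp
qed

lemma A_log_concave:
  assumes n: "n \<ge> 1" and g: "g \<ge> 1"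
  shows "A n (g - 1) * A n (g + 1) \<le> (A n g)\<^sup>2"
proof (cases "g + 1 \<le> n div 2")
  case False
  then have "A n (g + 1) = 0" using n by (intro A_eq_0) auto
  then show ?thesis by simp
next
  case True
  define c where "c k = Re (coeff (H n) k)" for k
  have "coeff (H n) k = complex_of_real (c k)" for k
  proof -
    have "Im (coeff (H n) k) = 0"
      by (simp add: H_def coeff_sum if_distrib[of Im] cong: if_cong)
    then show ?thesis by (simp add: c_def complex_eq_iff)
  qed
  then have lc: "c k * c (k + 2) \<le> (c (k + 1)) ^ 2" for k
    using H_root[OF n] by (intro log_concave_coeff)
  \<comment> \<open>\<open>H\<close> lists the numbers \<open>A n g\<close> by decreasing
    \<open>g\<close>, so \<open>k\<close>, \<open>k + 1\<close>, \<open>k + 2\<close> correspond to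
    \<open>g + 1\<close>, \<open>g\<close>, \<open>g - 1\<close>.\<close>
  define k where "k = (n + 1) div 2 - (g + 1)"
  have "g + 1 \<le> (n + 1) div 2"
    using True by (rule order.trans) (simp add: div_le_mono)
  then obtain d where "(n + 1) div 2 = g + 1 + d"
    using le_Suc_ex by blast
  then have "k + 1 = (n + 1) div 2 - g" "k + 2 = (n + 1) div 2 - (g - 1)"
    using g by (simp_all only: k_def)
  moreover have le: "g \<le> n div 2" "g - 1 \<le> n div 2"
    using True by linarith+
  ultimately have "c k = A n (g + 1)" "c (k + 1) = A n g" "c (k + 2) = A n (g - 1)"
    using coeff_H[OF True] coeff_H[of g n] coeff_H[of "g - 1" n] le by (simp_all add: c_def k_def)
  then have "real (A n (g - 1) * A n (g + 1)) \<le> real ((A n g)\<^sup>2)"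
    using lc[of k] by (simp add: mult.commute)
  then show ?thesis by (simp only: of_nat_le_iff)
qed

theorem corollary3p2:
  fixes n :: nat
  assumes "n \<ge> 1"
  shows "(\<forall>z :: complex. poly (H n) z = 0 \<longrightarrow> z \<in> \<real> \<and> Re z \<le> 0) \<and>
         (\<forall>g \<ge> 1. (A n g)\<^sup>2 \<ge> A n (g - 1) * A n (g + 1))"
  using H_root[OF assms] A_log_concave[OF assms] by blast

end
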